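(* For $p \in (0,1)$ let $\mathcal{S}(p)$ denote the unconstrained ER-type random numerical semigroup with parameter $p$. Then, as $p \to 0^+$, $$\mathrm{E}[\mathrm{e}(\mathcal{S}(p))] = O\left(\left(\ln\left(\tfrac{1}{p}\right)\right)^3\right)$$ and $$\mathrm{E}[\mathrm{g}(\mathcal{S}(p))] \le \mathrm{E}[\mathrm{F}(\mathcal{S}(p))] = O\left(\frac{1}{p}\left(\ln\left(\tfrac{1}{p}\right)\right)^3\right).$$ (Here "as $p\to 0^+$" means that there are constants $C, p_0>0$ such that the inequality $\mathrm{E}[\mathrm{g}] \le \mathrm{E}[\mathrm{F}]$ and the bounds with implied constant $C$ hold for all $p\in(0,p_0)$.)
   Context: Unconstrained ER-type random numerical semigroup $\mathcal{S}(p)$: choose a random set $\mathcal{A}$ of positive integers by putting each positive integer $n$ in $\mathcal{A}$ with probability $p$, these events being mutually independent; the random semigroup is $\mathcal{S} = \langle \mathcal{A}\rangle$, the set of all finite sums of elements of $\mathcal{A}$ with repetition allowed (including the empty sum $0$). For $0<p<1$ it is cofinite in $\mathbb{N}=\{0,1,2,\dots\}$ with probability one. For a cofinite subsemigroup $\mathcal{S}\subseteq\mathbb{N}$ containing $0$ (a numerical semigroup), a gap is an element of $\mathbb{N}\setminus\mathcal{S}$. The embedding dimension $\mathrm{e}(\mathcal{S})$ is the size of its unique minimal generating set; the Frobenius number $\mathrm{F}(\mathcal{S})$ is the largest gap (with the convention $\mathrm{F}(\mathbb{N})=-1$); the genus $\mathrm{g}(\mathcal{S})$ is the number of gaps. 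*)

theory Defs
  imports "HOL-Probability.Probability" "HOL-Library.Landau_Symbols"
begin

definition semigroup_generated :: "nat set \<Rightarrow> nat set" where
  "semigroup_generated A = sum_list ` lists A"

definition minimal_generating_set :: "nat set \<Rightarrow> nat set \<Rightarrow> bool" where
  "minimal_generating_set S B \<longleftrightarrow>
     semigroup_generated B = S \<and> (\<forall>C. C \<subset> B \<longrightarrow> semigroup_generated C \<noteq> S)"

text \<open>Every subsemigroup of the naturals containing 0 has exactly one minimal generating set,
  so the description below is proper for such sets.\<close>

definition embedding_dimension :: "nat set \<Rightarrow> nat" where
  "embedding_dimension S = card (THE B. minimal_generating_set S B)"

text \<open>The next two definitions are meaningful for cofinite \<open>S\<close>; on other sets they return
  unspecified or default values. The random semigroup below is cofinite almost surely when
  \<open>0 < p < 1\<close>, so these values do not affect expectations.\<close>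

definition frobenius_number :: "nat set \<Rightarrow> int" where
  "frobenius_number S = (if S = UNIV then - 1 else int (Max (- S)))"

definition genus :: "nat set \<Rightarrow> nat" where
  "genus S = card (- S)"

text \<open>A realisation, on an arbitrary probability space, of the random set of positive integers;
  note that \<^term>\<open>indep_events\<close> also asserts that the events are measurable.\<close>

locale ER_random_set = prob_space M
  for M :: "'a measure" and A :: "'a \<Rightarrow> nat set" and p :: real +
  assumes positive: "\<And>\<omega>. \<omega> \<in> space M \<Longrightarrow> 0 \<notin> A \<omega>"
    and indep: "indep_events (\<lambda>n. {\<omega> \<in> space M. n \<in> A \<omega>}) {1..}"
    and prob_mem: "\<And>n. n \<ge> 1 \<Longrightarrow> prob {\<omega> \<in> space M. n \<in> A \<omega>} = p"

end

theory Submission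
  imports Defs "HOL-Number_Theory.Cong" "HOL-Real_Asymp.Real_Asymp"
begin

text \<open>Fix a scale \<open>W\<close> and let \<open>q\<close> be the least element of \<open>A\<close>; with high probability \<open>q \<le> W\<close>. Starting
  from \<open>{0}\<close>, use the elements of \<open>A\<close> in successive blocks of length \<open>W\<close> to enlarge a set \<open>R\<close> of
  residues modulo \<open>q\<close>. The average over \<open>a\<close> of \<open>|R \<inter> (R + a)|\<close> is \<open>|R|\<^sup>2 / q\<close>, so as long as
  \<open>2 |R| \<le> q\<close> a positive proportion of the \<open>a\<close> in a block satisfy \<open>|R \<union> (R + a)| \<ge> 5/4 |R|\<close>, and \<open>A\<close>
  contains one of them except with probability exponentially small in \<open>p W\<close>. After \<open>J = O(ln W)\<close>
  blocks \<open>R\<close> contains more than half of the residues, hence \<open>R + R\<close> contains all of them, and every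
  integer from \<open>2 (J + 1)\<^sup>2 W\<close> on lies in the semigroup. Taking \<open>W\<close> of order \<open>ln (1/p) / p\<close> gives the
  threshold \<open>f = O(ln (1/p)\<^sup>3 / p)\<close>, and the multiples of this \<open>W\<close> control the tails. Irreducible
  elements are then at most \<open>2 f\<close> and belong to \<open>A\<close>, so not many more than \<open>2 f p\<close> are expected.\<close>

section \<open>Semigroups generated by a set of naturals\<close>

lemma semigroup_generated_0: "0 \<in> semigroup_generated A"
  unfolding semigroup_generated_def by (rule image_eqI[of _ _ "[]"]) auto

lemma semigroup_generated_gen: "a \<in> A \<Longrightarrow> a \<in> semigroup_generated A"
  unfolding semigroup_generated_def by (rule image_eqI[of _ _ "[a]"]) auto

lemma semigroup_generated_add:
  assumes "a \<in> semigroup_generated A" "b \<in> semigroup_generated A"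
  shows "a + b \<in> semigroup_generated A"
proof -
  obtain xs ys where "xs \<in> lists A" "a = sum_list xs" "ys \<in> lists A" "b = sum_list ys"
    using assms unfolding semigroup_generated_def by auto
  then show ?thesis
    unfolding semigroup_generated_def by (intro image_eqI[of _ _ "xs @ ys"]) auto
qed

lemma semigroup_generated_mult:
  "a \<in> semigroup_generated A \<Longrightarrow> c * a \<in> semigroup_generated A"
  by (induction c) (auto simp: semigroup_generated_0 semigroup_generated_add)

lemma semigroup_generated_least:
  assumes "A \<subseteq> T" "0 \<in> T" "\<And>a b. a \<in> T \<Longrightarrow> b \<in> T \<Longrightarrow> a + b \<in> T"
  shows "semigroup_generated A \<subseteq> T"
proof -
  have "sum_list xs \<in> T" if "xs \<in> lists A" for xs
    using that by induction (use assms in auto)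
  then show ?thesis by (auto simp: semigroup_generated_def)
qed

text \<open>No summand exceeds the sum. Hence membership of \<open>n\<close> depends on finitely
  many elements of \<open>A\<close>, which later gives measurability.\<close>

lemma semigroup_generated_restrict:
  "n \<in> semigroup_generated A \<longleftrightarrow> n \<in> semigroup_generated (A \<inter> {..n})"
proof
  assume "n \<in> semigroup_generated A"
  then obtain xs where xs: "xs \<in> lists A" "n = sum_list xs"
    unfolding semigroup_generated_def by auto
  then have "xs \<in> lists (A \<inter> {..n})"
    by (auto simp: member_le_sum_list in_lists_conv_set)
  with xs show "n \<in> semigroup_generated (A \<inter> {..n})"
    unfolding semigroup_generated_def by blast
next
  assume "n \<in> semigroup_generated (A \<inter> {..n})"
  then show "n \<in> semigroup_generated A"
    unfolding semigroup_generated_def by auto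
qed

section \<open>Irreducible elements and the embedding dimension\<close>

text \<open>The atoms of \<open>S\<close>. They give an explicit form of the minimal generating set
  that \<open>embedding_dimension\<close> picks by \<open>THE\<close>.\<close>

definition irreducibles :: "nat set \<Rightarrow> nat set" where
  "irreducibles S = {n \<in> S. n \<noteq> 0 \<and> (\<forall>a\<in>S. \<forall>b\<in>S. n = a + b \<longrightarrow> a = 0 \<or> b = 0)}"

text \<open>In a list of generators with irreducible sum, the head or the sum of the tail must
  vanish; so the sum is the head, or it is already the sum of the tail.\<close>

lemma irreducibles_subset_generators:
  "irreducibles (semigroup_generated A) \<subseteq> A"
proof
  fix n assume n: "n \<in> irreducibles (semigroup_generated A)"
  then obtain xs where "xs \<in> lists A" "n = sum_list xs"
    unfolding semigroup_generated_def irreducibles_def by auto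
  then show "n \<in> A"
  proof (induction xs)
    case (Cons x xs)
    have "x \<in> semigroup_generated A" "sum_list xs \<in> semigroup_generated A"
      using Cons.hyps by (auto simp: semigroup_generated_gen) (auto simp: semigroup_generated_def)
    then have "x = 0 \<or> sum_list xs = 0"
      using n Cons.prems by (auto simp: irreducibles_def)
    then show ?case
    proof
      assume "x = 0"
      then show ?thesis using Cons by simp
    next
      assume "sum_list xs = 0"
      then show ?thesis using Cons.hyps Cons.prems by (simp only: sum_list.Cons add_0_right)
    qed
  qed (use n in \<open>auto simp: irreducibles_def\<close>)
qed

text \<open>A nonzero element that is not irreducible splits into two strictly smaller elements of
  the semigroup, so strong induction applies.\<close>

lemma semigroup_generated_irreducibles:
  "semigroup_generated (irreducibles (semigroup_generated A)) = semigroup_generated A"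
    (is "semigroup_generated ?I = ?S")
proof
  show "semigroup_generated ?I \<subseteq> ?S"
    by (rule semigroup_generated_least)
       (auto simp: irreducibles_def semigroup_generated_0 semigroup_generated_add)
  show "?S \<subseteq> semigroup_generated ?I"
  proof
    fix n assume "n \<in> ?S"
    then show "n \<in> semigroup_generated ?I"
    proof (induction n rule: less_induct)
      case (less n)
      show ?case
      proof (cases "n = 0 \<or> n \<in> ?I")
        case True
        then show ?thesis by (auto simp: semigroup_generated_0 semigroup_generated_gen)
      next
        case False
        then obtain a b where ab: "a \<in> ?S" "b \<in> ?S" "n = a + b" "a \<noteq> 0" "b \<noteq> 0"
          using less.prems by (auto simp: irreducibles_def)
        then show ?thesis using less.IH[of a] less.IH[of b] by (auto simp: semigroup_generated_add)
      qed
    qed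
  qed
qed

text \<open>The irreducibles generate and lie in every generating set, so they form the only minimal
  one.\<close>

lemma embedding_dimension_semigroup_generated:
  "embedding_dimension (semigroup_generated A) = card (irreducibles (semigroup_generated A))"
proof -
  let ?S = "semigroup_generated A"
  have sub: "irreducibles ?S \<subseteq> B" if "semigroup_generated B = ?S" for B
    using irreducibles_subset_generators[of B] that by simp
  have "(THE B. minimal_generating_set ?S B) = irreducibles ?S"
  proof (rule the_equality)
    show "minimal_generating_set ?S (irreducibles ?S)"
      using sub semigroup_generated_irreducibles by (auto simp: minimal_generating_set_def)
  next
    fix B assume "minimal_generating_set ?S B"
    then show "B = irreducibles ?S"
      using sub[of B] semigroup_generated_irreducibles[of A]
      by (auto simp: minimal_generating_set_def)
  qed
  then show ?thesis by (simp add: embedding_dimension_def)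
qed

section \<open>Bounds on the invariants from a threshold beyond which there are no gaps\<close>

text \<open>Beyond \<open>2 * f\<close> the splitting \<open>n = f + (n - f)\<close> has both parts
  in \<open>S\<close> and nonzero.\<close>

lemma irreducibles_le:
  assumes "\<And>n. n \<ge> f \<Longrightarrow> n \<in> S" and "f \<ge> 1" and "n \<in> irreducibles S"
  shows "n \<le> 2 * f"
proof (rule ccontr)
  assume "\<not> n \<le> 2 * f"
  then have f: "f \<in> S" "n - f \<in> S" "n = f + (n - f)" "f \<noteq> 0" "n - f \<noteq> 0"
    using assms(1)[of "n - f"] assms(1)[of f] assms(2) by auto
  have "\<And>a b. a \<in> S \<Longrightarrow> b \<in> S \<Longrightarrow> n = a + b \<Longrightarrow> a = 0 \<or> b = 0"
    using assms(3) by (auto simp: irreducibles_def)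
  from this[OF f(1-3)] show False using f(4,5) by simp
qed

text \<open>All gaps lie below \<open>f\<close>; the bound \<open>f \<ge> 1\<close> covers the value
  -1 taken at \<open>UNIV\<close>.\<close>

lemma abs_frobenius_number_le:
  assumes "\<And>n. n \<ge> f \<Longrightarrow> n \<in> S" and "f \<ge> 1"
  shows "\<bar>frobenius_number S\<bar> \<le> int f"
proof (cases "S = UNIV")
  case True
  then show ?thesis using assms by (simp add: frobenius_number_def)
next
  case False
  have "- S \<subseteq> {..f}" using assms(1) by (auto simp: not_le intro: ccontr)
  moreover from this have "finite (- S)" by (rule finite_subset) simp
  moreover have "- S \<noteq> {}" using False by auto
  ultimately have "Max (- S) \<le> f" using Max_in[of "- S"] by blast
  then show ?thesis using False by (simp add: frobenius_number_def)
qed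

text \<open>The gaps lie between 1 and the largest one. If there are infinitely many,
  \<open>card\<close> is 0 and the right side is still nonnegative, being the image of a natural
  number.\<close>

lemma genus_le_frobenius_number:
  assumes "0 \<in> S" "S \<noteq> UNIV"
  shows "int (genus S) \<le> frobenius_number S"
proof (cases "finite (- S)")
  case True
  have "- S \<subseteq> {1..Max (- S)}"
    using True assms(1) by (auto simp: Suc_le_eq intro: Max_ge gr0I)
  from card_mono[OF _ this] show ?thesis
    using assms(2) by (simp add: genus_def frobenius_number_def)
qed (simp add: genus_def frobenius_number_def assms)

text \<open>At \<open>UNIV\<close> the genus is 0 and the Frobenius number -1, which the absolute
  value repairs. This dominates the genus in the proof of its integrability.\<close>

lemma genus_le_abs_frobenius_number:
  assumes "0 \<in> S"
  shows "int (genus S) \<le> \<bar>frobenius_number S\<bar>"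
  using genus_le_frobenius_number[OF assms] by (cases "S = UNIV") (auto simp: genus_def)

text \<open>The element \<open>a\<close> of \<open>S\<close> lies below the gap \<open>b\<close>, so it is not counted by the genus.\<close>

lemma genus_less_frobenius_number:
  assumes "0 \<in> S" "a \<in> S" "b \<notin> S" "0 < a" "a < b" "finite (- S)"
  shows "int (genus S) + 1 \<le> frobenius_number S"
proof -
  have "b \<le> Max (- S)" using assms by (intro Max_ge) auto
  then have a: "a \<in> {1..Max (- S)}" using assms(4,5) by simp
  have "- S \<subseteq> {1..Max (- S)} - {a}"
    using assms by (auto simp: Suc_le_eq intro: Max_ge gr0I)
  from card_mono[OF _ this] have "card (- S) \<le> Max (- S) - 1" using a by simp
  then show ?thesis
    using assms a by (auto simp: genus_def frobenius_number_def)
qed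

section \<open>Growth of residue sets under shifts\<close>

text \<open>Double counting: a window of \<open>q\<close> consecutive integers contains at most one
  shift that takes a given \<open>r\<close> to a given \<open>r'\<close> modulo
  \<open>q\<close>.\<close>

lemma card_Int_shift_sum_le:
  fixes q b :: nat
  assumes R: "R \<subseteq> {..<q}"
  shows "(\<Sum>a\<in>{b..<b + q}. card (R \<inter> (\<lambda>r. (r + a) mod q) ` R)) \<le> card R * card R"
proof -
  have fin: "finite R" using R finite_subset by blast
  let ?D = "SIGMA a:{b..<b + q}. R \<inter> (\<lambda>r. (r + a) mod q) ` R"
  have "(\<Sum>a\<in>{b..<b + q}. card (R \<inter> (\<lambda>r. (r + a) mod q) ` R)) = card ?D"
    using fin by (subst card_SigmaI) auto
  \<comment> \<open>The pair \<open>(r, r')\<close> determines the shift, which \<open>THE\<close>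
    recovers; thus \<open>?D\<close> lies in an image of \<open>R \<times> R\<close>.\<close>
  also have "\<dots> \<le> card ((\<lambda>(r, r'). (THE a. a \<in> {b..<b + q} \<and> (r + a) mod q = r', r')) ` (R \<times> R))"
  proof (rule card_mono)
    show "finite ((\<lambda>(r, r'). (THE a. a \<in> {b..<b + q} \<and> (r + a) mod q = r', r')) ` (R \<times> R))"
      using fin by simp
    have *: "a = a'" if "a \<in> {b..<b + q}" "a' \<in> {b..<b + q}" "(r + a) mod q = (r + a') mod q"
      for a a' r :: nat
    proof -
      have "[r + a = r + a'] (mod q)" using that by (simp add: cong_def)
      then have "[a = a'] (mod q)" by (simp only: cong_add_lcancel_nat)
      then have "[a - b + b = a' - b + b] (mod q)" using that by simp
      then have "[a - b = a' - b] (mod q)" by (simp only: cong_add_rcancel_nat)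
      then show ?thesis using that by (auto simp: cong_def)
    qed
    show "?D \<subseteq> (\<lambda>(r, r'). (THE a. a \<in> {b..<b + q} \<and> (r + a) mod q = r', r')) ` (R \<times> R)"
    proof clarify
      fix a r assume a: "a \<in> {b..<b + q}" and r: "r \<in> R" "(r + a) mod q \<in> R"
      have "(THE c. c \<in> {b..<b + q} \<and> (r + c) mod q = (r + a) mod q) = a"
        by (rule the_equality) (use a * in blast)+
      then show "(a, (r + a) mod q) \<in> (\<lambda>(r, r'). (THE a. a \<in> {b..<b + q} \<and> (r + a) mod q = r', r')) ` (R \<times> R)"
        using r by (intro image_eqI[of _ _ "(r, (r + a) mod q)"]) auto
    qed
  qed
  also have "\<dots> \<le> card (R \<times> R)" using fin by (intro card_image_le) auto
  finally show ?thesis by (simp add: card_cartesian_product)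
qed

text \<open>Growth by a factor of at least 5/4, with the denominator cleared to stay in
  \<open>nat\<close>.\<close>

definition expanding :: "nat \<Rightarrow> nat set \<Rightarrow> nat \<Rightarrow> bool" where
  "expanding q R a \<longleftrightarrow> 5 * card R \<le> 4 * card (R \<union> (\<lambda>r. (r + a) mod q) ` R)"

text \<open>A shift that is not expanding meets \<open>R\<close> in at least 3/4 of its elements. As
  the intersections have total size at most \<open>card R\<close> squared, at most 4/3
  \<open>card R\<close>, hence at most 2/3 \<open>q\<close>, of the shifts are of this kind.\<close>

lemma card_expanding_period:
  fixes q b :: nat
  assumes R: "R \<subseteq> {..<q}" and small: "2 * card R \<le> q"
  shows "q \<le> 3 * card {a \<in> {b..<b + q}. expanding q R a}"
proof (cases "card R = 0")
  case True
  then have "{a \<in> {b..<b + q}. expanding q R a} = {b..<b + q}" by (auto simp: expanding_def)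
  then show ?thesis by simp
next
  case False
  have fin: "finite R" using R finite_subset by blast
  define t where "t a = (\<lambda>r. (r + a) mod q) ` R" for a
  define bad where "bad = {a \<in> {b..<b + q}. \<not> expanding q R a}"
  have card_t: "card (t a) = card R" for a
    unfolding t_def
  proof (intro card_image inj_onI)
    fix r r' assume r: "r \<in> R" "r' \<in> R" "(r + a) mod q = (r' + a) mod q"
    then have "[r = r'] (mod q)" by (simp add: cong_def[symmetric] cong_add_rcancel_nat)
    then show "r = r'" using r R by (auto simp: cong_def subset_iff)
  qed
  have bad: "3 * card R \<le> 4 * card (R \<inter> t a)" if "a \<in> bad" for a
  proof -
    have "card R + card R = card (R \<union> t a) + card (R \<inter> t a)"
      using card_Un_Int[OF fin, of "t a"] fin card_t[of a] by (simp add: t_def)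
    moreover have "4 * card (R \<union> t a) < 5 * card R"
      using that by (simp add: bad_def expanding_def t_def not_le)
    ultimately show ?thesis by linarith
  qed
  have "3 * card R * card bad = (\<Sum>a\<in>bad. 3 * card R)" by simp
  also have "\<dots> \<le> (\<Sum>a\<in>bad. 4 * card (R \<inter> t a))" using bad by (intro sum_mono) auto
  also have "\<dots> \<le> (\<Sum>a\<in>{b..<b + q}. 4 * card (R \<inter> t a))"
    by (rule sum_mono2) (auto simp: bad_def)
  also have "\<dots> \<le> 4 * (card R * card R)"
    using card_Int_shift_sum_le[OF R, of b] by (simp add: sum_distrib_left[symmetric] t_def)
  finally have "card R * (3 * card bad) \<le> card R * (4 * card R)" by (simp add: algebra_simps)
  then have "3 * card bad \<le> 4 * card R" using False by simp
  moreover have "card {a \<in> {b..<b + q}. expanding q R a} + card bad = q"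
  proof -
    have "{a \<in> {b..<b + q}. expanding q R a} \<union> bad = {b..<b + q}" by (auto simp: bad_def)
    moreover have "card ({a \<in> {b..<b + q}. expanding q R a} \<union> bad) =
        card {a \<in> {b..<b + q}. expanding q R a} + card bad"
      by (rule card_Un_disjoint) (auto simp: bad_def)
    ultimately show ?thesis by simp
  qed
  ultimately show ?thesis using small by linarith
qed

lemma card_expanding_periods:
  fixes q b :: nat
  assumes "R \<subseteq> {..<q}" and "2 * card R \<le> q"
  shows "d * q \<le> 3 * card {a \<in> {b..<b + d * q}. expanding q R a}"
proof (induction d)
  case (Suc d)
  let ?X = "\<lambda>b c. {a \<in> {b..<c}. expanding q R a}"
  have "?X b (b + Suc d * q) = ?X b (b + d * q) \<union> ?X (b + d * q) (b + d * q + q)"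
    by auto
  moreover have "card (?X b (b + d * q) \<union> ?X (b + d * q) (b + d * q + q)) =
      card (?X b (b + d * q)) + card (?X (b + d * q) (b + d * q + q))"
    by (rule card_Un_disjoint) auto
  ultimately show ?case
    using Suc card_expanding_period[OF assms, of "b + d * q"] by simp
qed simp

text \<open>The full periods cover at least half of a block of length \<open>W \<ge> q\<close>, and
  a third of their elements expand; hence the factor 6.\<close>

lemma card_expanding:
  fixes q W :: nat
  assumes "R \<subseteq> {..<q}" "2 * card R \<le> q" "1 \<le> q" "q \<le> W"
  shows "W \<le> 6 * card {a \<in> {b<..b + W}. expanding q R a}"
proof -
  let ?d = "W div q"
  have "?d * q \<le> 3 * card {a \<in> {Suc b..<Suc b + ?d * q}. expanding q R a}"
    by (rule card_expanding_periods[OF assms(1,2)])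
  also have "card {a \<in> {Suc b..<Suc b + ?d * q}. expanding q R a} \<le>
      card {a \<in> {b<..b + W}. expanding q R a}"
  proof (rule card_mono)
    have "{Suc b..<Suc b + c} \<subseteq> {b<..b + W}" if "c \<le> W" for c using that by auto
    then have "{Suc b..<Suc b + ?d * q} \<subseteq> {b<..b + W}"
      using div_times_less_eq_dividend[of W q] by blast
    then show "{a \<in> {Suc b..<Suc b + ?d * q}. expanding q R a} \<subseteq> {a \<in> {b<..b + W}. expanding q R a}"
      by blast
  qed simp
  finally have "?d * q \<le> 3 * card {a \<in> {b<..b + W}. expanding q R a}" by simp
  moreover have "W \<le> 2 * (?d * q)"
  proof -
    have "1 * q \<le> ?d * q" using assms div_greater_zero_iff[of W q] by (intro mult_le_mono1) linarith
    moreover have "W mod q < q" using assms by simp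
    moreover have "W = ?d * q + W mod q" by simp
    ultimately show ?thesis by linarith
  qed
  ultimately show ?thesis by linarith
qed

section \<open>Block sums, their residues, and a deterministic criterion for cofiniteness\<close>

text \<open>Each step adds at most one element of a fresh block. The block \<open>{1..W}\<close> is
  left out, since it supplies the modulus.\<close>

fun block_sums :: "nat \<Rightarrow> nat set \<Rightarrow> nat \<Rightarrow> nat set" where
  "block_sums W A 0 = {0}"
| "block_sums W A (Suc j) = block_sums W A j \<union>
     {u + a |u a. u \<in> block_sums W A j \<and> a \<in> A \<inter> {Suc j * W<..Suc j * W + W}}"

lemma block_sums_subset: "block_sums W A j \<subseteq> semigroup_generated A"
proof (induction j)
  case (Suc j)
  then have "u + a \<in> semigroup_generated A" if "u \<in> block_sums W A j" "a \<in> A" for u a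
    using that semigroup_generated_add semigroup_generated_gen by blast
  then show ?case using Suc by auto
qed (simp add: semigroup_generated_0)

text \<open>The summands are at most \<open>2 * W\<close>, ..., \<open>(j + 1) * W\<close>. This
  quadratic growth accounts for two of the three logarithmic factors in the final bound.\<close>

lemma block_sums_le: "u \<in> block_sums W A j \<Longrightarrow> u \<le> (j + 1)\<^sup>2 * W"
proof (induction j arbitrary: u)
  case (Suc j)
  show ?case
  proof (cases "u \<in> block_sums W A j")
    case True
    then have "u \<le> (j + 1)\<^sup>2 * W" by (rule Suc.IH)
    also have "\<dots> \<le> (Suc j + 1)\<^sup>2 * W" by (intro mult_le_mono1 power_mono) auto
    finally show ?thesis .
  next
    case False
    then obtain v a where v: "u = v + a" "v \<in> block_sums W A j" "a \<le> Suc j * W + W"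
      using Suc.prems by auto
    with Suc.IH[of v] have "u \<le> (j + 1)\<^sup>2 * W + (Suc j * W + W)" by linarith
    also have "\<dots> \<le> (Suc j + 1)\<^sup>2 * W" by (simp add: power2_eq_square algebra_simps)
    finally show ?thesis .
  qed
qed simp

text \<open>The first \<open>j\<close> steps use elements up to \<open>Suc j * W\<close> only, so
  the sums built so far do not depend on the next block.\<close>

lemma block_sums_restrict:
  assumes "Suc j * W \<le> n"
  shows "block_sums W (A \<inter> {1..n}) j = block_sums W A j"
  using assms
proof (induction j)
  case (Suc j)
  have "A \<inter> {1..n} \<inter> {Suc j * W<..Suc j * W + W} = A \<inter> {Suc j * W<..Suc j * W + W}"
    using Suc.prems by auto
  moreover have "block_sums W (A \<inter> {1..n}) j = block_sums W A j"
    using Suc by simp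
  ultimately show ?case by (simp only: block_sums.simps)
qed simp

definition block_residues :: "nat \<Rightarrow> nat set \<Rightarrow> nat \<Rightarrow> nat \<Rightarrow> nat set" where
  "block_residues W A q j = (\<lambda>u. u mod q) ` block_sums W A j"

lemma block_residues_subset: "1 \<le> q \<Longrightarrow> block_residues W A q j \<subseteq> {..<q}"
  by (auto simp: block_residues_def)

lemma block_residues_Suc_expanding:
  assumes "1 \<le> q" "a \<in> A" "a \<in> {Suc j * W<..Suc j * W + W}"
    and "expanding q (block_residues W A q j) a"
  shows "5 * card (block_residues W A q j) \<le> 4 * card (block_residues W A q (Suc j))"
proof -
  let ?R = "block_residues W A q j"
  have "(r + a) mod q \<in> block_residues W A q (Suc j)" if r: "r \<in> ?R" for r
  proof -
    obtain u where u: "u \<in> block_sums W A j" "r = u mod q" using r by (auto simp: block_residues_def)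
    then have "u + a \<in> block_sums W A (Suc j)" using assms(2,3) by auto
    then have "(u + a) mod q \<in> block_residues W A q (Suc j)"
      unfolding block_residues_def by (rule imageI)
    then show ?thesis using u by (simp add: mod_add_left_eq)
  qed
  moreover have "?R \<subseteq> block_residues W A q (Suc j)" by (auto simp: block_residues_def)
  ultimately have "?R \<union> (\<lambda>r. (r + a) mod q) ` ?R \<subseteq> block_residues W A q (Suc j)" by blast
  moreover have "finite (block_residues W A q (Suc j))"
    using block_residues_subset[OF assms(1)] by (rule finite_subset) simp
  ultimately have "card (?R \<union> (\<lambda>r. (r + a) mod q) ` ?R) \<le> card (block_residues W A q (Suc j))"
    by (simp only: card_mono)
  then show ?thesis using assms(4) by (simp add: expanding_def)
qed

text \<open>Pigeonhole: \<open>R\<close> meets its reflection \<open>t - R\<close> modulo \<open>q\<close>.\<close>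

lemma residues_sum_cover:
  fixes q t :: nat
  assumes "R \<subseteq> {..<q}" "q < 2 * card R"
  shows "\<exists>r\<in>R. \<exists>r'\<in>R. (r + r') mod q = t mod q"
proof -
  let ?f = "\<lambda>r. (t + (q - r)) mod q"
  have fin: "finite R" using assms finite_subset by blast
  have q: "q > 0" using assms by (cases q) auto
  have "inj_on ?f R"
  proof (rule inj_onI)
    fix r r' assume r: "r \<in> R" "r' \<in> R" "?f r = ?f r'"
    then have "[t + (q - r) = t + (q - r')] (mod q)" by (simp add: cong_def)
    then have "[q - r = q - r'] (mod q)" by (simp only: cong_add_lcancel_nat)
    \<comment> \<open>Adding \<open>r + r'\<close> to both sides removes the truncated
      subtractions.\<close>
    then have "[(q - r) + (r + r') = (q - r') + (r + r')] (mod q)"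
      by (simp only: cong_add_rcancel_nat)
    moreover have "(q - r) + (r + r') = q + r'" "(q - r') + (r + r') = q + r"
      using r assms by auto
    ultimately have "r mod q = r' mod q" by (simp add: cong_def)
    then show "r = r'" using r assms(1) by (auto simp: subset_iff)
  qed
  then have "card (?f ` R) = card R" by (rule card_image)
  moreover have "card (R \<union> ?f ` R) \<le> q"
  proof -
    have "R \<union> ?f ` R \<subseteq> {..<q}" using assms q by auto
    from card_mono[OF _ this] show ?thesis by simp
  qed
  moreover have "card (R \<union> ?f ` R) + card (R \<inter> ?f ` R) = card R + card (?f ` R)"
    using card_Un_Int[OF fin, of "?f ` R"] fin by simp
  ultimately have "card (R \<inter> ?f ` R) \<noteq> 0" using assms(2) by linarith
  then have "R \<inter> ?f ` R \<noteq> {}" by (metis card.empty)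
  then obtain r where r: "r \<in> R" "?f r \<in> R" by blast
  have "(r + ?f r) mod q = (r + (t + (q - r))) mod q" by (simp add: mod_simps)
  also have "r + (t + (q - r)) = t + q" using r assms by auto
  finally show ?thesis using r by auto
qed

text \<open>The set of elements of the \<open>(j+1)\<close>st block whose presence in \<open>A\<close> makes the block residues
  grow; it is determined by the part \<open>B\<close> of \<open>A\<close> preceding that block.\<close>

definition useful :: "nat \<Rightarrow> nat \<Rightarrow> nat set \<Rightarrow> nat set" where
  "useful W j B = {a \<in> {Suc j * W<..Suc j * W + W}.
     B \<inter> {1..W} \<noteq> {} \<longrightarrow> 2 * card (block_residues W B (Min (B \<inter> {1..W})) j) \<le> Min (B \<inter> {1..W}) \<longrightarrow>
     expanding (Min (B \<inter> {1..W})) (block_residues W B (Min (B \<inter> {1..W})) j) a}"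

text \<open>If there is no modulus, or the residues already exceed half of it, the premises in
  \<open>useful\<close> fail and the whole block counts. The bound thus holds for every
  \<open>B\<close>, as the conditioning on the past requires.\<close>

lemma card_useful: "W \<le> 6 * card (useful W j B)"
proof (cases "B \<inter> {1..W} \<noteq> {} \<and>
    2 * card (block_residues W B (Min (B \<inter> {1..W})) j) \<le> Min (B \<inter> {1..W})")
  case True
  have "Min (B \<inter> {1..W}) \<in> B \<inter> {1..W}" using True by (intro Min_in) auto
  then show ?thesis
    using True card_expanding[of _ _ W] block_residues_subset
    by (simp add: useful_def)
next
  case False
  then have "useful W j B = {Suc j * W<..Suc j * W + W}" unfolding useful_def by blast
  then show ?thesis by simp
qed

text \<open>Growth by 5/4 per block yields more than half of the residues modulo \<open>q\<close>,
  the least element of \<open>A\<close> in \<open>{1..W}\<close>. Two block sums then represent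
  \<open>n\<close> modulo \<open>q\<close>, and copies of \<open>q\<close> fill up the
  difference.\<close>

lemma semigroup_generated_cofinite:
  assumes first: "A \<inter> {1..W} \<noteq> {}"
    and step: "\<And>j. j < J \<Longrightarrow> A \<inter> useful W j (A \<inter> {1..Suc j * W}) \<noteq> {}"
    and J: "real W \<le> (5 / 4) ^ J"
    and n: "2 * (J + 1)\<^sup>2 * W \<le> n"
  shows "n \<in> semigroup_generated A"
proof -
  define q where "q = Min (A \<inter> {1..W})"
  have "q \<in> A \<inter> {1..W}" unfolding q_def using first by (intro Min_in) auto
  then have q: "q \<in> A" "1 \<le> q" "q \<le> W" by auto
  let ?R = "block_residues W A q"
  have fin: "finite (?R j)" for j
    using block_residues_subset[OF q(2)] by (rule finite_subset) simp
  \<comment> \<open>Expansion is guaranteed only up to half of the residues, so the invariant allows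
    for having passed that point.\<close>
  have "q < 2 * card (?R j) \<or> (5 / 4) ^ j \<le> real (card (?R j))" if "j \<le> J" for j
    using that
  proof (induction j)
    case 0
    then show ?case by (simp add: block_residues_def)
  next
    case (Suc j)
    show ?case
    proof (cases "q < 2 * card (?R j)")
      case True
      have "?R j \<subseteq> ?R (Suc j)" by (auto simp: block_residues_def)
      then have "card (?R j) \<le> card (?R (Suc j))" using fin card_mono by blast
      then show ?thesis using True by simp
    next
      case False
      let ?B = "A \<inter> {1..Suc j * W}"
      obtain a where a: "a \<in> A" "a \<in> useful W j ?B" using step[of j] Suc.prems by auto
      \<comment> \<open>\<open>useful\<close> sees only the truncated set \<open>?B\<close>; this
        and the next fact identify its modulus and residues with those of \<open>A\<close>.\<close>
      have "?B \<inter> {1..W} = A \<inter> {1..W}" by auto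
      moreover have "block_residues W ?B q j = ?R j"
        using block_sums_restrict[of j W "Suc j * W" A] by (simp add: block_residues_def)
      ultimately have "a \<in> {Suc j * W<..Suc j * W + W} \<and>
          (A \<inter> {1..W} \<noteq> {} \<longrightarrow> 2 * card (?R j) \<le> q \<longrightarrow> expanding q (?R j) a)"
        using a(2) by (simp only: useful_def q_def[symmetric] mem_Collect_eq) blast
      then have "a \<in> {Suc j * W<..Suc j * W + W}" "expanding q (?R j) a"
        using first False by auto
      from block_residues_Suc_expanding[OF q(2) a(1) this]
      have "5 * real (card (?R j)) \<le> 4 * real (card (?R (Suc j)))"
        by (metis of_nat_le_iff of_nat_mult of_nat_numeral)
      moreover have "(5 / 4) ^ j \<le> real (card (?R j))" using Suc False by simp
      ultimately show ?thesis by simp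
    qed
  qed
  \<comment> \<open>Otherwise \<open>(5 / 4) ^ J\<close> would be at most \<open>q / 2\<close>,
    which is less than \<open>W\<close>.\<close>
  from this[of J] have "q < 2 * card (?R J)" using J q by auto
  from residues_sum_cover[OF block_residues_subset[OF q(2)] this, of n]
  obtain u v where uv: "u \<in> block_sums W A J" "v \<in> block_sums W A J"
    "(u mod q + v mod q) mod q = n mod q"
    by (auto simp: block_residues_def)
  then have "(u + v) mod q = n mod q" by (simp add: mod_simps)
  \<comment> \<open>Each of the two block sums is at most \<open>(J + 1)\<^sup>2 * W\<close>; hence
    the factor 2 in the hypothesis on \<open>n\<close>.\<close>
  moreover have "u + v \<le> n" using block_sums_le[OF uv(1)] block_sums_le[OF uv(2)] n by simp
  ultimately have "q dvd n - (u + v)" using mod_eq_dvd_iff_nat by metis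
  then obtain c where "n - (u + v) = c * q" by (metis dvdE mult.commute)
  then have "n = u + v + c * q" using \<open>u + v \<le> n\<close> by simp
  moreover have "u \<in> semigroup_generated A" "v \<in> semigroup_generated A"
    using uv block_sums_subset by blast+
  ultimately show ?thesis
    by (simp only: semigroup_generated_add semigroup_generated_mult semigroup_generated_gen[OF q(1)])
qed

section \<open>Independence and the probability of failure at one scale\<close>

context ER_random_set
begin

lemma p_nonneg: "0 \<le> p" and p_le_1: "p \<le> 1"
  using prob_mem[of 1] prob_le_1[of "{\<omega> \<in> space M. 1 \<in> A \<omega>}"]
    measure_nonneg[of M "{\<omega> \<in> space M. 1 \<in> A \<omega>}"] by auto

lemma pred_mem [measurable]: "Measurable.pred M (\<lambda>\<omega>. n \<in> A \<omega>)"
proof (cases "n = 0")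
  \<comment> \<open>The event for 0 is not among the independent events, but \<open>positive\<close>
    makes it empty.\<close>
  case True
  then have "{\<omega> \<in> space M. n \<in> A \<omega>} = {}" using positive by auto
  then show ?thesis by (simp only: pred_def sets.empty_sets)
next
  case False
  then show ?thesis using indep by (auto simp: pred_def indep_events_def)
qed

lemma sets_pattern: "{\<omega> \<in> space M. X \<subseteq> A \<omega> \<and> A \<omega> \<inter> Y = {}} \<in> events"
proof -
  have "{\<omega> \<in> space M. X \<subseteq> A \<omega> \<and> A \<omega> \<inter> Y = {}} =
      {\<omega> \<in> space M. (\<forall>x. x \<in> X \<longrightarrow> x \<in> A \<omega>) \<and> (\<forall>y. y \<in> Y \<longrightarrow> y \<notin> A \<omega>)}"
    by auto
  also have "\<dots> \<in> events" by measurable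
  finally show ?thesis .
qed

text \<open>The independence assumption speaks of presence only. Absence of a further
  \<open>y\<close> is handled by subtracting the probability of the same pattern with
  \<open>y\<close> present.\<close>

lemma prob_pattern:
  assumes "finite X" "finite Y" "X \<subseteq> {1..}" "Y \<subseteq> {1..}" "X \<inter> Y = {}"
  shows "prob {\<omega> \<in> space M. X \<subseteq> A \<omega> \<and> A \<omega> \<inter> Y = {}} = p ^ card X * (1 - p) ^ card Y"
  using assms(2,1,3-)
proof (induction Y arbitrary: X rule: finite_induct)
  case empty
  show ?case
  proof (cases "X = {}")
    case True
    then show ?thesis by (simp add: prob_space)
  next
    case False
    have "{\<omega> \<in> space M. X \<subseteq> A \<omega> \<and> A \<omega> \<inter> {} = {}} = (\<Inter>n\<in>X. {\<omega> \<in> space M. n \<in> A \<omega>})"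
      using False by auto
    also have "prob \<dots> = (\<Prod>n\<in>X. prob {\<omega> \<in> space M. n \<in> A \<omega>})"
      using indep empty False by (auto simp: indep_events_def)
    also have "\<dots> = (\<Prod>n\<in>X. p)"
      using empty by (intro prod.cong refl prob_mem) auto
    finally show ?thesis by simp
  qed
next
  case (insert y Y)
  let ?E = "\<lambda>X Y. {\<omega> \<in> space M. X \<subseteq> A \<omega> \<and> A \<omega> \<inter> Y = {}}"
  have "?E X (insert y Y) = ?E X Y - ?E (insert y X) Y" by auto
  moreover have "prob (?E X Y - ?E (insert y X) Y) = prob (?E X Y) - prob (?E (insert y X) Y)"
    by (rule finite_measure_Diff[OF sets_pattern sets_pattern]) auto
  moreover have "prob (?E X Y) = p ^ card X * (1 - p) ^ card Y"
    using insert by (intro insert.IH) auto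
  moreover have "prob (?E (insert y X) Y) = p ^ card (insert y X) * (1 - p) ^ card Y"
    using insert by (intro insert.IH) auto
  moreover have "card (insert y X) = Suc (card X)" using insert by simp
  moreover have "card (insert y Y) = Suc (card Y)" using insert by simp
  ultimately show ?case by (simp add: algebra_simps)
qed

lemma sets_restrict_eq: "{\<omega> \<in> space M. A \<omega> \<inter> {1..n} = B \<and> A \<omega> \<inter> G = {}} \<in> events"
proof -
  have "{\<omega> \<in> space M. A \<omega> \<inter> {1..n} = B \<and> A \<omega> \<inter> G = {}} =
      {\<omega> \<in> space M. (\<forall>x. (x \<in> A \<omega> \<and> x \<in> {1..n}) = (x \<in> B)) \<and> (\<forall>y. y \<in> G \<longrightarrow> y \<notin> A \<omega>)}"
    by (auto simp: set_eq_iff)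
  also have "\<dots> \<in> events" by measurable
  finally show ?thesis .
qed

text \<open>The trace of the random set on \<open>{1..n}\<close> takes finitely many values, so the
  event is measurable for an arbitrary function \<open>G\<close>.\<close>

lemma avoid_eq_Union:
  "{\<omega> \<in> space M. A \<omega> \<inter> G (A \<omega> \<inter> {1..n}) = {}} =
     (\<Union>B\<in>Pow {1..n}. {\<omega> \<in> space M. A \<omega> \<inter> {1..n} = B \<and> A \<omega> \<inter> G B = {}})"
proof (rule set_eqI)
  fix \<omega>
  have "A \<omega> \<inter> {1..n} \<in> Pow {1..n}" by simp
  then show "\<omega> \<in> {\<omega> \<in> space M. A \<omega> \<inter> G (A \<omega> \<inter> {1..n}) = {}} \<longleftrightarrow>
      \<omega> \<in> (\<Union>B\<in>Pow {1..n}. {\<omega> \<in> space M. A \<omega> \<inter> {1..n} = B \<and> A \<omega> \<inter> G B = {}})"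
    unfolding UN_iff mem_Collect_eq by metis
qed

lemma sets_avoid: "{\<omega> \<in> space M. A \<omega> \<inter> G (A \<omega> \<inter> {1..n}) = {}} \<in> events"
  unfolding avoid_eq_Union by (intro sets.finite_UN sets_restrict_eq) auto

text \<open>The elements up to \<open>n\<close> and those above \<open>n\<close> are independent, so condition on the former.\<close>

lemma prob_avoid_le:
  assumes G: "\<And>B. B \<subseteq> {1..n} \<Longrightarrow> finite (G B) \<and> G B \<subseteq> {n<..} \<and> r \<le> card (G B)"
  shows "prob {\<omega> \<in> space M. A \<omega> \<inter> G (A \<omega> \<inter> {1..n}) = {}} \<le> (1 - p) ^ r"
proof -
  let ?E = "\<lambda>B C. {\<omega> \<in> space M. A \<omega> \<inter> {1..n} = B \<and> A \<omega> \<inter> C = {}}"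
  have eq: "prob (?E B C) = p ^ card B * (1 - p) ^ card ({1..n} - B) * (1 - p) ^ card C"
    if "B \<subseteq> {1..n}" "finite C" "C \<subseteq> {n<..}" for B C
  proof -
    have "B \<inter> C = {}" using that(1,3) by (force simp: subset_iff)
    have "?E B C = {\<omega> \<in> space M. B \<subseteq> A \<omega> \<and> A \<omega> \<inter> (({1..n} - B) \<union> C) = {}}"
      using that by auto
    also have "prob \<dots> = p ^ card B * (1 - p) ^ card (({1..n} - B) \<union> C)"
      using that finite_subset[OF that(1)] \<open>B \<inter> C = {}\<close> by (intro prob_pattern) auto
    also have "card (({1..n} - B) \<union> C) = card ({1..n} - B) + card C"
      using that by (intro card_Un_disjoint) auto
    finally show ?thesis by (simp add: power_add)
  qed
  have "prob {\<omega> \<in> space M. A \<omega> \<inter> G (A \<omega> \<inter> {1..n}) = {}} \<le> (\<Sum>B\<in>Pow {1..n}. prob (?E B (G B)))"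
    unfolding avoid_eq_Union
    by (rule finite_measure_subadditive_finite) (simp, use sets_restrict_eq in blast)
  also have "\<dots> \<le> (\<Sum>B\<in>Pow {1..n}. prob (?E B {}) * (1 - p) ^ r)"
  proof (rule sum_mono)
    fix B assume B: "B \<in> Pow {1..n}"
    have "(1 - p) ^ card (G B) \<le> (1 - p) ^ r"
      using G[of B] B p_nonneg p_le_1 by (intro power_decreasing) auto
    then show "prob (?E B (G B)) \<le> prob (?E B {}) * (1 - p) ^ r"
      using B G[of B] p_nonneg p_le_1 eq[of B "G B"] eq[of B "{}"]
      by (auto intro!: mult_left_mono)
  qed
  also have "\<dots> = prob (\<Union>B\<in>Pow {1..n}. ?E B {}) * (1 - p) ^ r"
  proof -
    have "(\<lambda>B. ?E B {}) ` Pow {1..n} \<subseteq> events" using sets_restrict_eq by blast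
    moreover have "disjoint_family_on (\<lambda>B. ?E B {}) (Pow {1..n})"
      by (auto simp: disjoint_family_on_def)
    ultimately have "prob (\<Union>B\<in>Pow {1..n}. ?E B {}) = (\<Sum>B\<in>Pow {1..n}. prob (?E B {}))"
      by (intro finite_measure_finite_Union) simp_all
    then show ?thesis by (simp only: sum_distrib_right)
  qed
  also have "\<dots> \<le> 1 * (1 - p) ^ r"
    using p_le_1 by (intro mult_right_mono) auto
  finally show ?thesis by simp
qed

text \<open>Off this event the hypotheses \<open>first\<close> and \<open>step\<close> of
  \<open>semigroup_generated_cofinite\<close> hold.\<close>

definition fails :: "nat \<Rightarrow> nat \<Rightarrow> 'a set" where
  "fails W J = {\<omega> \<in> space M. A \<omega> \<inter> {1..W} = {}} \<union>
     (\<Union>j<J. {\<omega> \<in> space M. A \<omega> \<inter> useful W j (A \<omega> \<inter> {1..Suc j * W}) = {}})"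

lemma sets_fails [measurable]: "fails W J \<in> events"
  unfolding fails_def using sets_pattern[of "{}" "{1..W}"] sets_avoid
  by (auto intro!: sets.Un sets.finite_UN)

text \<open>Union bound over \<open>J + 1\<close> events, each of which requires at least
  \<open>W / 6\<close> integers to be absent.\<close>

lemma prob_fails: "prob (fails W J) \<le> real (J + 1) * exp (- (p * real W / 6))"
proof -
  have pow: "(1 - p) ^ m \<le> exp (- (p * real W / 6))" if "real W / 6 \<le> real m" for m
  proof -
    have "(1 - p) ^ m \<le> exp (- p) ^ m"
      using p_le_1 exp_ge_add_one_self[of "- p"] by (intro power_mono) auto
    also have "\<dots> = exp (- (p * real m))" by (simp add: exp_of_nat_mult[symmetric] algebra_simps)
    also have "\<dots> \<le> exp (- (p * real W / 6))"
      using mult_left_mono[OF that p_nonneg] by simp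
    finally show ?thesis .
  qed
  have "prob {\<omega> \<in> space M. A \<omega> \<inter> {1..W} = {}} = (1 - p) ^ W"
    using prob_pattern[of "{}" "{1..W}"] by (simp cong: conj_cong)
  also have "\<dots> \<le> exp (- (p * real W / 6))" by (rule pow) simp
  finally have 1: "prob {\<omega> \<in> space M. A \<omega> \<inter> {1..W} = {}} \<le> exp (- (p * real W / 6))" .
  \<comment> \<open>\<open>W / 6\<close> rounded up, the integer form of the bound in
    \<open>card_useful\<close>.\<close>
  define r where "r = (W + 5) div 6"
  have 2: "prob {\<omega> \<in> space M. A \<omega> \<inter> useful W j (A \<omega> \<inter> {1..Suc j * W}) = {}}
      \<le> exp (- (p * real W / 6))" for j
  proof -
    have "prob {\<omega> \<in> space M. A \<omega> \<inter> useful W j (A \<omega> \<inter> {1..Suc j * W}) = {}} \<le> (1 - p) ^ r"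
    proof (rule prob_avoid_le, intro conjI)
      fix B
      show "useful W j B \<subseteq> {Suc j * W<..}" by (auto simp: useful_def)
      have "useful W j B \<subseteq> {Suc j * W<..Suc j * W + W}" by (auto simp: useful_def)
      then show "finite (useful W j B)" by (rule finite_subset) simp
      show "r \<le> card (useful W j B)" using card_useful[of W j B] by (simp add: r_def)
    qed
    also have "\<dots> \<le> exp (- (p * real W / 6))"
    proof (rule pow)
      have "W \<le> 6 * r" unfolding r_def by linarith
      then show "real W / 6 \<le> real r" by linarith
    qed
    finally show ?thesis .
  qed
  have "prob (fails W J) \<le> prob {\<omega> \<in> space M. A \<omega> \<inter> {1..W} = {}} +
      prob (\<Union>j<J. {\<omega> \<in> space M. A \<omega> \<inter> useful W j (A \<omega> \<inter> {1..Suc j * W}) = {}})"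
    unfolding fails_def using sets_pattern[of "{}" "{1..W}"] sets_avoid
    by (intro measure_Un_le) (auto intro!: sets.finite_UN)
  also have "\<dots> \<le> exp (- (p * real W / 6)) + (\<Sum>j<J. exp (- (p * real W / 6)))"
  proof (rule add_mono[OF 1])
    have "prob (\<Union>j<J. {\<omega> \<in> space M. A \<omega> \<inter> useful W j (A \<omega> \<inter> {1..Suc j * W}) = {}}) \<le>
        (\<Sum>j<J. prob {\<omega> \<in> space M. A \<omega> \<inter> useful W j (A \<omega> \<inter> {1..Suc j * W}) = {}})"
      using sets_avoid by (intro finite_measure_subadditive_finite) auto
    also have "\<dots> \<le> (\<Sum>j<J. exp (- (p * real W / 6)))" using 2 by (rule sum_mono)
    finally show "prob (\<Union>j<J. {\<omega> \<in> space M. A \<omega> \<inter> useful W j (A \<omega> \<inter> {1..Suc j * W}) = {}})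
        \<le> (\<Sum>j<J. exp (- (p * real W / 6)))" .
  qed
  finally show ?thesis by (simp add: algebra_simps)
qed

lemma mem_semigroup_generated_not_fails:
  assumes "\<omega> \<in> space M" "\<omega> \<notin> fails W J" "real W \<le> (5 / 4) ^ J" "2 * (J + 1)\<^sup>2 * W \<le> n"
  shows "n \<in> semigroup_generated (A \<omega>)"
  using assms by (intro semigroup_generated_cofinite[of _ W J]) (auto simp: fails_def)

section \<open>Measurability of the invariants and the expected number of generators\<close>

lemma pred_mem_semigroup_generated [measurable]:
  "Measurable.pred M (\<lambda>\<omega>. n \<in> semigroup_generated (A \<omega>))"
proof -
  have *: "n \<in> semigroup_generated (A \<omega>) \<longleftrightarrow> n \<in> semigroup_generated (A \<omega> \<inter> {1..n})"
    if "\<omega> \<in> space M" for \<omega>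
  proof -
    have "A \<omega> \<inter> {..n} = A \<omega> \<inter> {1..n}"
      using positive[OF that] by (auto simp: Suc_le_eq intro: gr0I)
    then show ?thesis using semigroup_generated_restrict[of n "A \<omega>"] by simp
  qed
  \<comment> \<open>The vacuous condition on \<open>{}\<close> gives the events the shape of
    \<open>sets_restrict_eq\<close>.\<close>
  have "{\<omega> \<in> space M. n \<in> semigroup_generated (A \<omega>)} =
      (\<Union>B\<in>{B \<in> Pow {1..n}. n \<in> semigroup_generated B}. {\<omega> \<in> space M. A \<omega> \<inter> {1..n} = B \<and> A \<omega> \<inter> {} = {}})"
    using * by auto
  also have "\<dots> \<in> events" by (intro sets.finite_UN sets_restrict_eq) auto
  finally show ?thesis by (simp add: pred_def)
qed

lemma measurable_genus [measurable]:
  "(\<lambda>\<omega>. genus (semigroup_generated (A \<omega>))) \<in> measurable M (count_space UNIV)"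
  unfolding genus_def by (intro measurable_card) (auto simp: pred_def[symmetric])

lemma measurable_embedding_dimension [measurable]:
  "(\<lambda>\<omega>. embedding_dimension (semigroup_generated (A \<omega>))) \<in> measurable M (count_space UNIV)"
  unfolding embedding_dimension_semigroup_generated
proof (intro measurable_card)
  fix n
  have "{\<omega> \<in> space M. n \<in> irreducibles (semigroup_generated (A \<omega>))} =
    {\<omega> \<in> space M. n \<in> semigroup_generated (A \<omega>) \<and> n \<noteq> 0 \<and>
      (\<forall>a b. a \<in> semigroup_generated (A \<omega>) \<longrightarrow> b \<in> semigroup_generated (A \<omega>) \<longrightarrow>
        n = a + b \<longrightarrow> a = 0 \<or> b = 0)}"
    by (auto simp: irreducibles_def)
  also have "\<dots> \<in> events" by measurable
  finally show "{\<omega> \<in> space M. n \<in> irreducibles (semigroup_generated (A \<omega>))} \<in> events" .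
qed

lemma measurable_frobenius_number [measurable]:
  "(\<lambda>\<omega>. frobenius_number (semigroup_generated (A \<omega>))) \<in> measurable M (count_space UNIV)"
proof -
  have "(\<lambda>\<omega>. frobenius_number (semigroup_generated (A \<omega>))) =
    (\<lambda>\<omega>. if \<forall>n. n \<in> semigroup_generated (A \<omega>) then - 1
      else int (Max {n. n \<notin> semigroup_generated (A \<omega>)}))"
    by (auto simp: frobenius_number_def Compl_eq fun_eq_iff)
  also have "\<dots> \<in> measurable M (count_space UNIV)" by measurable
  finally show ?thesis .
qed

lemma nn_integral_card:
  "(\<integral>\<^sup>+\<omega>. ennreal (real (card (A \<omega> \<inter> {1..n}))) \<partial>M) = ennreal (real n * p)"
proof -
  have "(\<integral>\<^sup>+\<omega>. ennreal (real (card (A \<omega> \<inter> {1..n}))) \<partial>M) =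
      (\<integral>\<^sup>+\<omega>. (\<Sum>k\<in>{1..n}. indicator {\<omega> \<in> space M. k \<in> A \<omega>} \<omega>) \<partial>M)"
  proof (rule nn_integral_cong)
    fix \<omega> assume "\<omega> \<in> space M"
    have "real (card (A \<omega> \<inter> {1..n})) = (\<Sum>k\<in>{1..n} \<inter> A \<omega>. 1)" by (simp add: Int_commute)
    also have "\<dots> = (\<Sum>k\<in>{1..n}. if k \<in> A \<omega> then 1 else 0)" by (rule sum.inter_restrict) simp
    finally have "ennreal (real (card (A \<omega> \<inter> {1..n}))) = ennreal (\<Sum>k\<in>{1..n}. if k \<in> A \<omega> then 1 else 0)"
      by simp
    also have "\<dots> = (\<Sum>k\<in>{1..n}. ennreal (if k \<in> A \<omega> then 1 else 0))"
      by (rule sum_ennreal[symmetric]) simp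
    also have "\<dots> = (\<Sum>k\<in>{1..n}. indicator {\<omega> \<in> space M. k \<in> A \<omega>} \<omega>)"
      using \<open>\<omega> \<in> space M\<close> by (intro sum.cong) auto
    finally show "ennreal (real (card (A \<omega> \<inter> {1..n}))) = (\<Sum>k\<in>{1..n}. indicator {\<omega> \<in> space M. k \<in> A \<omega>} \<omega>)" .
  qed
  also have "\<dots> = (\<Sum>k\<in>{1..n}. \<integral>\<^sup>+\<omega>. indicator {\<omega> \<in> space M. k \<in> A \<omega>} \<omega> \<partial>M)"
    by (rule nn_integral_sum) measurable
  also have "\<dots> = (\<Sum>k\<in>{1..n}. ennreal p)"
  proof (rule sum.cong[OF refl])
    fix k assume "k \<in> {1..n}"
    have "(\<integral>\<^sup>+\<omega>. indicator {\<omega> \<in> space M. k \<in> A \<omega>} \<omega> \<partial>M) = emeasure M {\<omega> \<in> space M. k \<in> A \<omega>}"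
      by (rule nn_integral_indicator) measurable
    then show "(\<integral>\<^sup>+\<omega>. indicator {\<omega> \<in> space M. k \<in> A \<omega>} \<omega> \<partial>M) = ennreal p"
      using prob_mem[of k] \<open>k \<in> {1..n}\<close> by (simp add: emeasure_eq_measure)
  qed
  also have "\<dots> = ennreal (real n * p)"
    using p_nonneg by (simp add: ennreal_of_nat_eq_real_of_nat ennreal_mult)
  finally show ?thesis .
qed

end

section \<open>Summation over all scales\<close>

text \<open>An absolute constant. The fourth power combines the cubic growth of the threshold with
  the linear factor in the failure probability at scale \<open>k\<close>.\<close>

definition geometric_const :: real where
  "geometric_const = (\<Sum>k. real (k + 2) ^ 4 * (1 / 2) ^ k)"

lemma summable_geometric_const: "summable (\<lambda>k. real (k + 2) ^ 4 * (1 / 2) ^ k)"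
proof (rule summable_comparison_test_bigo)
  show "summable (\<lambda>k. norm ((3 / 4) ^ k :: real))" by simp
  show "(\<lambda>k. real (k + 2) ^ 4 * (1 / 2) ^ k) \<in> O(\<lambda>k. (3 / 4) ^ k)" by real_asymp
qed

lemma geometric_const_nonneg: "0 \<le> geometric_const"
  unfolding geometric_const_def by (intro suminf_nonneg summable_geometric_const) simp

text \<open>With \<open>B k\<close> the failure event at scale \<open>k\<close>, a quantity that is at most \<open>(k + 1)\<^sup>3 y\<close> unless scale
  \<open>k\<close> fails is controlled by this penalty, because the scale before the first success fails.\<close>

definition penalty :: "(nat \<Rightarrow> 'a set) \<Rightarrow> 'a \<Rightarrow> ennreal" where
  "penalty B \<omega> = (\<Sum>k. ennreal (real (k + 2) ^ 3) * indicator (B k) \<omega>)"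

lemma penalty_ge: "\<omega> \<in> B k \<Longrightarrow> ennreal (real (k + 2) ^ 3) \<le> penalty B \<omega>"
  using sum_le_suminf[of "\<lambda>k. ennreal (real (k + 2) ^ 3) * indicator (B k) \<omega>" "{k}"]
  by (simp add: penalty_def)

text \<open>The terms are unbounded if every scale fails. A finite expected penalty therefore makes
  some scale succeed almost surely.\<close>

lemma penalty_eq_top:
  assumes "\<And>k. \<omega> \<in> B k"
  shows "penalty B \<omega> = top"
proof (rule ccontr)
  assume "penalty B \<omega> \<noteq> top"
  then obtain n where n: "penalty B \<omega> < of_nat n"
    using ennreal_Ex_less_of_nat[of "penalty B \<omega>"] by (auto simp: less_top)
  have "real n \<le> real (n + 2)" by simp
  also have "\<dots> \<le> real (n + 2) ^ 3" by (rule self_le_power) auto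
  finally have "ennreal (real n) \<le> ennreal (real (n + 2) ^ 3)" by (rule ennreal_leI)
  also have "\<dots> \<le> penalty B \<omega>" by (rule penalty_ge[OF assms])
  finally have "ennreal (real n) \<le> penalty B \<omega>" .
  with n show False by (simp add: ennreal_of_nat_eq_real_of_nat)
qed

text \<open>Consider the least successful scale: at 0 the bound is \<open>y0\<close>, at
  \<open>i + 1\<close> the failure of \<open>i\<close> pays for it, and if there is none the penalty
  is infinite. The separate \<open>y0\<close> permits a sharper bound at scale 0.\<close>

lemma ennreal_le_penalty:
  assumes "\<omega> \<notin> B 0 \<Longrightarrow> x \<le> y0"
    and "\<And>k. \<omega> \<notin> B k \<Longrightarrow> x \<le> real (k + 1) ^ 3 * y" and "0 < y"
  shows "ennreal x \<le> ennreal y0 + ennreal y * penalty B \<omega>"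
proof (cases "\<exists>k. \<omega> \<notin> B k")
  case True
  define k where "k = (LEAST k. \<omega> \<notin> B k)"
  have k: "\<omega> \<notin> B k" unfolding k_def using True by (rule LeastI_ex)
  show ?thesis
  proof (cases k)
    case 0
    then have "ennreal x \<le> ennreal y0" using k assms(1) by (intro ennreal_leI) simp
    then show ?thesis by (simp add: add_increasing2)
  next
    case (Suc i)
    then have "\<omega> \<in> B i" using not_less_Least[of i "\<lambda>k. \<omega> \<notin> B k"] by (auto simp: k_def)
    have "ennreal x \<le> ennreal (y * real (i + 2) ^ 3)"
      using assms(2)[OF k] Suc by (intro ennreal_leI) (simp add: mult.commute)
    also have "\<dots> = ennreal y * ennreal (real (i + 2) ^ 3)"
      using assms(3) by (intro ennreal_mult) auto
    also have "\<dots> \<le> ennreal y * penalty B \<omega>"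
      by (intro mult_left_mono penalty_ge \<open>\<omega> \<in> B i\<close>) simp
    finally show ?thesis by (simp add: add_increasing)
  qed
next
  case False
  then have "penalty B \<omega> = top" by (intro penalty_eq_top) auto
  then show ?thesis using assms(3) by (simp add: ennreal_mult_top)
qed

context prob_space
begin

lemma measurable_penalty [measurable]:
  assumes [measurable]: "\<And>k. B k \<in> events"
  shows "penalty B \<in> borel_measurable M"
  unfolding penalty_def[abs_def] by measurable

lemma nn_integral_penalty_le:
  assumes [measurable]: "\<And>k. B k \<in> events"
    and prob: "\<And>k. prob (B k) \<le> real (k + 1) * (c * (1 / 2) ^ k)"
    and "0 \<le> c"
  shows "(\<integral>\<^sup>+\<omega>. penalty B \<omega> \<partial>M) \<le> ennreal (c * geometric_const)"
proof -
  have "(\<integral>\<^sup>+\<omega>. penalty B \<omega> \<partial>M) = (\<Sum>k. \<integral>\<^sup>+\<omega>. ennreal (real (k + 2) ^ 3) * indicator (B k) \<omega> \<partial>M)"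
    unfolding penalty_def by (rule nn_integral_suminf) measurable
  also have "\<dots> = (\<Sum>k. ennreal (real (k + 2) ^ 3 * prob (B k)))"
    by (simp add: nn_integral_cmult_indicator emeasure_eq_measure ennreal_mult)
  also have "\<dots> \<le> (\<Sum>k. ennreal (c * (real (k + 2) ^ 4 * (1 / 2) ^ k)))"
  proof (intro suminf_le ennreal_leI summableI)
    fix k
    have "real (k + 2) ^ 3 * prob (B k) \<le> real (k + 2) ^ 3 * (real (k + 1) * (c * (1 / 2) ^ k))"
      by (intro mult_left_mono prob) simp
    \<comment> \<open>Weakening \<open>k + 1\<close> to \<open>k + 2\<close> produces the fourth
      power in \<open>geometric_const\<close>.\<close>
    also have "\<dots> \<le> real (k + 2) ^ 3 * (real (k + 2) * (c * (1 / 2) ^ k))"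
      using \<open>0 \<le> c\<close> by (intro mult_left_mono mult_right_mono) auto
    also have "\<dots> = c * (real (k + 2) ^ 4 * (1 / 2) ^ k)"
      by (simp only: power4_eq_xxxx power3_eq_cube mult_ac)
    finally show "real (k + 2) ^ 3 * prob (B k) \<le> c * (real (k + 2) ^ 4 * (1 / 2) ^ k)" .
  qed
  also have "\<dots> = ennreal (\<Sum>k. c * (real (k + 2) ^ 4 * (1 / 2) ^ k))"
    using \<open>0 \<le> c\<close> by (intro suminf_ennreal2 summable_mult summable_geometric_const) auto
  also have "\<dots> = ennreal (c * geometric_const)"
    unfolding geometric_const_def by (subst suminf_mult[OF summable_geometric_const]) simp
  finally show ?thesis .
qed

end

section \<open>Expectation bounds for a fixed small parameter\<close>

text \<open>\<open>W_ge\<close> gives \<open>exp (- (p * W / 6)) \<le> p ^ 2\<close>,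
  \<open>J_le\<close> absorbs the factor of the union bound, and \<open>W_le\<close> provides enough
  growth steps; \<open>W_ge_2\<close> carries the latter over to the larger scales.\<close>

locale scaled_ER_random_set = ER_random_set +
  fixes W J :: nat
  assumes p_pos: "0 < p" and p_le_half: "p \<le> 1 / 2"
    and W_ge_2: "2 \<le> W"
    and W_ge: "12 * ln (1 / p) / p \<le> real W"
    and W_le: "real W \<le> (5 / 4) ^ J"
    and J_le: "real (J + 1) * p \<le> 1"
begin

text \<open>Scale \<open>k\<close> multiplies both block length and number of steps by
  \<open>k + 1\<close>, so the threshold grows by at most the cube.\<close>

definition bad :: "nat \<Rightarrow> 'a set" where
  "bad k = fails (Suc k * W) (Suc k * J)"

definition threshold :: nat where
  "threshold = 2 * (J + 1)\<^sup>2 * W"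

lemma threshold_pos: "1 \<le> threshold"
  using W_ge_2 by (simp add: threshold_def Suc_le_eq)

lemma sets_bad [measurable]: "bad k \<in> events"
  by (simp add: bad_def)

text \<open>The exponential is at most \<open>p ^ (2 * (k + 1))\<close>. One factor \<open>p\<close>
  absorbs \<open>J + 1\<close>, one is kept, and the others are turned into powers of 1/2. The
  embedding dimension relies on the one kept.\<close>

lemma prob_bad: "prob (bad k) \<le> real (k + 1) * (p * (1 / 2) ^ k)"
proof -
  have "real (Suc k) * (2 * ln (1 / p)) \<le> real (Suc k) * (p * real W / 6)"
    using W_ge p_pos by (intro mult_left_mono) (auto simp: field_simps)
  also have "\<dots> = p * real (Suc k * W) / 6"
    by (simp only: of_nat_mult) (simp add: field_simps)
  finally have "exp (- (p * real (Suc k * W) / 6)) \<le> exp (real (Suc k) * (2 * ln p))"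
    using p_pos by (simp add: ln_div)
  also have "\<dots> = exp (2 * ln p) ^ Suc k" by (rule exp_of_nat_mult)
  also have "exp (2 * ln p) = p ^ 2"
    using p_pos exp_of_nat_mult[of 2 "ln p"] by simp
  finally have e: "exp (- (p * real (Suc k * W) / 6)) \<le> (p ^ 2) ^ Suc k" .
  have "prob (bad k) \<le> real (Suc k * J + 1) * exp (- (p * real (Suc k * W) / 6))"
    unfolding bad_def by (rule prob_fails)
  also have "\<dots> \<le> (real (k + 1) * real (J + 1)) * (p ^ 2) ^ Suc k"
    by (intro mult_mono e) (auto simp: algebra_simps)
  also have "\<dots> = real (k + 1) * ((real (J + 1) * p) * p * (p ^ 2) ^ k)"
    by (simp add: power2_eq_square)
  also have "\<dots> \<le> real (k + 1) * (1 * p * (1 / 2) ^ k)"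
  proof -
    have "p ^ 2 \<le> p * 1" unfolding power2_eq_square using p_pos p_le_half by (intro mult_left_mono) auto
    then have "p ^ 2 \<le> 1 / 2" using p_le_half by simp
    then show ?thesis
      using J_le p_pos by (intro mult_mono power_mono) auto
  qed
  finally show ?thesis by simp
qed

lemma nn_integral_penalty_bad: "(\<integral>\<^sup>+\<omega>. penalty bad \<omega> \<partial>M) \<le> ennreal (p * geometric_const)"
  by (rule nn_integral_penalty_le) (use prob_bad p_nonneg in auto)

lemma mem_semigroup_generated_not_bad:
  assumes "\<omega> \<in> space M" "\<omega> \<notin> bad k" "(k + 1) ^ 3 * threshold \<le> n"
  shows "n \<in> semigroup_generated (A \<omega>)"
proof (rule mem_semigroup_generated_not_fails)
  show "\<omega> \<in> space M" "\<omega> \<notin> fails (Suc k * W) (Suc k * J)" using assms by (auto simp: bad_def)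
  \<comment> \<open>The growth condition at scale \<open>k\<close> is reduced to the power
    \<open>Suc k\<close> of the one at scale 0.\<close>
  have "real (Suc k * W) \<le> real W ^ Suc k"
  proof (induction k)
    case (Suc k)
    have "real (Suc (Suc k) * W) \<le> real (Suc k * W) * 2" by (simp add: algebra_simps)
    also have "\<dots> \<le> real W ^ Suc k * real W" using W_ge_2 Suc by (intro mult_mono) auto
    finally show ?case by (simp add: mult.commute)
  qed simp
  also have "\<dots> \<le> ((5 / 4) ^ J) ^ Suc k" using W_le by (intro power_mono) auto
  finally show "real (Suc k * W) \<le> (5 / 4) ^ (Suc k * J)"
    by (simp only: power_mult[symmetric] mult.commute)
  have "2 * (Suc k * J + 1)\<^sup>2 * (Suc k * W) \<le> 2 * (Suc k * (J + 1))\<^sup>2 * (Suc k * W)"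
    by (intro mult_le_mono power_mono) auto
  also have "\<dots> = (k + 1) ^ 3 * threshold"
    by (simp add: threshold_def power_mult_distrib power3_eq_cube power2_eq_square algebra_simps)
  finally show "2 * (Suc k * J + 1)\<^sup>2 * (Suc k * W) \<le> n" using assms(3) by simp
qed

lemma AE_cofinite: "AE \<omega> in M. finite (- semigroup_generated (A \<omega>))"
proof -
  have "(\<integral>\<^sup>+\<omega>. penalty bad \<omega> \<partial>M) \<noteq> \<infinity>"
    using nn_integral_penalty_bad by (auto simp: top_unique)
  then have "AE \<omega> in M. penalty bad \<omega> \<noteq> \<infinity>"
    by (intro nn_integral_PInf_AE) measurable
  then show ?thesis
  proof (rule AE_mp, intro AE_I2 impI)
    fix \<omega> assume \<omega>: "\<omega> \<in> space M" "penalty bad \<omega> \<noteq> \<infinity>"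
    then obtain k where "\<omega> \<notin> bad k" using penalty_eq_top[of \<omega> bad] by auto
    then have "- semigroup_generated (A \<omega>) \<subseteq> {..<(k + 1) ^ 3 * threshold}"
      using mem_semigroup_generated_not_bad[OF \<omega>(1)] by (auto simp: not_le[symmetric])
    then show "finite (- semigroup_generated (A \<omega>))" by (rule finite_subset) simp
  qed
qed

lemma nn_integral_abs_frobenius_number:
  "(\<integral>\<^sup>+\<omega>. ennreal \<bar>real_of_int (frobenius_number (semigroup_generated (A \<omega>)))\<bar> \<partial>M)
     \<le> ennreal (real threshold * (1 + geometric_const))"
proof -
  let ?F = "\<lambda>\<omega>. \<bar>real_of_int (frobenius_number (semigroup_generated (A \<omega>)))\<bar>"
  have "(\<integral>\<^sup>+\<omega>. ennreal (?F \<omega>) \<partial>M)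
      \<le> (\<integral>\<^sup>+\<omega>. ennreal (real threshold) + ennreal (real threshold) * penalty bad \<omega> \<partial>M)"
  proof (rule nn_integral_mono)
    fix \<omega> assume \<omega>: "\<omega> \<in> space M"
    have le: "?F \<omega> \<le> real (k + 1) ^ 3 * real threshold" if "\<omega> \<notin> bad k" for k
    proof -
      have "\<bar>frobenius_number (semigroup_generated (A \<omega>))\<bar> \<le> int ((k + 1) ^ 3 * threshold)"
        using mem_semigroup_generated_not_bad[OF \<omega> that] threshold_pos
        by (intro abs_frobenius_number_le) (auto simp: Suc_le_eq)
      then have "?F \<omega> \<le> real_of_int (int ((k + 1) ^ 3 * threshold))" by linarith
      then show ?thesis by simp
    qed
    show "ennreal (?F \<omega>) \<le> ennreal (real threshold) + ennreal (real threshold) * penalty bad \<omega>"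
      by (rule ennreal_le_penalty) (use le le[of 0] threshold_pos in auto)
  qed
  also have "\<dots> = ennreal (real threshold) + ennreal (real threshold) * (\<integral>\<^sup>+\<omega>. penalty bad \<omega> \<partial>M)"
    by (simp add: nn_integral_add nn_integral_cmult emeasure_space_1)
  \<comment> \<open>Here the factor \<open>p\<close> of the penalty bound is estimated by 1.\<close>
  also have "\<dots> \<le> ennreal (real threshold) + ennreal (real threshold) * ennreal (1 * geometric_const)"
    using p_le_1 geometric_const_nonneg
    by (intro add_left_mono mult_left_mono order_trans[OF nn_integral_penalty_bad] ennreal_leI mult_right_mono) auto
  also have "\<dots> = ennreal (real threshold * (1 + geometric_const))"
    using geometric_const_nonneg by (simp add: ennreal_mult[symmetric] ennreal_plus[symmetric] algebra_simps del: ennreal_plus)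
  finally show ?thesis .
qed

text \<open>At scale 0 only generators up to \<open>2 * threshold\<close> count, each present with
  probability \<open>p\<close>. At later scales all integers up to the cutoff are counted, which the
  factor \<open>p\<close> in the expected penalty compensates.\<close>

lemma nn_integral_embedding_dimension:
  "(\<integral>\<^sup>+\<omega>. ennreal (real (embedding_dimension (semigroup_generated (A \<omega>)))) \<partial>M)
     \<le> ennreal (2 * (real threshold * p) * (1 + geometric_const))"
proof -
  let ?e = "\<lambda>\<omega>. real (embedding_dimension (semigroup_generated (A \<omega>)))"
  let ?c = "\<lambda>\<omega>. real (card (A \<omega> \<inter> {1..2 * threshold}))"
  have "(\<integral>\<^sup>+\<omega>. ennreal (?e \<omega>) \<partial>M)
      \<le> (\<integral>\<^sup>+\<omega>. ennreal (?c \<omega>) + ennreal (real (2 * threshold)) * penalty bad \<omega> \<partial>M)"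
  proof (rule nn_integral_mono)
    fix \<omega> assume \<omega>: "\<omega> \<in> space M"
    have le: "embedding_dimension (semigroup_generated (A \<omega>)) \<le>
        card (A \<omega> \<inter> {1..2 * ((k + 1) ^ 3 * threshold)})" if "\<omega> \<notin> bad k" for k
    proof -
      have "irreducibles (semigroup_generated (A \<omega>)) \<subseteq> A \<omega> \<inter> {1..2 * ((k + 1) ^ 3 * threshold)}"
      proof
        fix n assume n: "n \<in> irreducibles (semigroup_generated (A \<omega>))"
        have "n \<le> 2 * ((k + 1) ^ 3 * threshold)"
          using mem_semigroup_generated_not_bad[OF \<omega> that] threshold_pos
          by (intro irreducibles_le[OF _ _ n]) (auto simp: Suc_le_eq)
        moreover have "n \<in> A \<omega>" using n irreducibles_subset_generators by blast
        moreover have "n \<noteq> 0" using n by (simp add: irreducibles_def)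
        ultimately show "n \<in> A \<omega> \<inter> {1..2 * ((k + 1) ^ 3 * threshold)}" by simp
      qed
      then show ?thesis
        unfolding embedding_dimension_semigroup_generated by (intro card_mono) auto
    qed
    show "ennreal (?e \<omega>) \<le> ennreal (?c \<omega>) + ennreal (real (2 * threshold)) * penalty bad \<omega>"
    proof (rule ennreal_le_penalty)
      show "?e \<omega> \<le> ?c \<omega>" if "\<omega> \<notin> bad 0" using le[OF that] by simp
      show "?e \<omega> \<le> real (k + 1) ^ 3 * real (2 * threshold)" if "\<omega> \<notin> bad k" for k
      proof -
        have "card (A \<omega> \<inter> {1..2 * ((k + 1) ^ 3 * threshold)}) \<le> card {1..2 * ((k + 1) ^ 3 * threshold)}"
          by (intro card_mono) auto
        then have "embedding_dimension (semigroup_generated (A \<omega>)) \<le> (k + 1) ^ 3 * (2 * threshold)"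
          using le[OF that] by simp
        then show ?thesis by (simp only: of_nat_le_iff of_nat_mult[symmetric] of_nat_power[symmetric])
      qed
      show "0 < real (2 * threshold)" using threshold_pos by simp
    qed
  qed
  also have "\<dots> = ennreal (real (2 * threshold) * p)
      + ennreal (real (2 * threshold)) * (\<integral>\<^sup>+\<omega>. penalty bad \<omega> \<partial>M)"
  proof -
    have [measurable]: "(\<lambda>\<omega>. card (A \<omega> \<inter> {1..2 * threshold})) \<in> measurable M (count_space UNIV)"
      by (intro measurable_card) simp
    have "(\<integral>\<^sup>+\<omega>. ennreal (?c \<omega>) + ennreal (real (2 * threshold)) * penalty bad \<omega> \<partial>M)
      = (\<integral>\<^sup>+\<omega>. ennreal (?c \<omega>) \<partial>M) + (\<integral>\<^sup>+\<omega>. ennreal (real (2 * threshold)) * penalty bad \<omega> \<partial>M)"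
      by (rule nn_integral_add) measurable
    then show ?thesis by (simp only: nn_integral_card nn_integral_cmult[OF measurable_penalty[OF sets_bad]])
  qed
  also have "\<dots> \<le> ennreal (real (2 * threshold) * p)
      + ennreal (real (2 * threshold)) * ennreal (p * geometric_const)"
    by (intro add_left_mono mult_left_mono nn_integral_penalty_bad) auto
  also have "\<dots> = ennreal (2 * (real threshold * p) * (1 + geometric_const))"
    using geometric_const_nonneg p_nonneg
    by (simp add: ennreal_mult[symmetric] ennreal_plus[symmetric] algebra_simps del: ennreal_plus)
  finally show ?thesis .
qed

lemma integrable_frobenius_number:
  "integrable M (\<lambda>\<omega>. real_of_int (frobenius_number (semigroup_generated (A \<omega>))))"
proof (rule integrableI_bounded)
  show "(\<integral>\<^sup>+\<omega>. ennreal (norm (real_of_int (frobenius_number (semigroup_generated (A \<omega>))))) \<partial>M) < \<infinity>"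
    using nn_integral_abs_frobenius_number by (auto simp: less_top[symmetric] top_unique)
qed measurable

lemma integrable_genus: "integrable M (\<lambda>\<omega>. real (genus (semigroup_generated (A \<omega>))))"
proof (rule Bochner_Integration.integrable_bound[OF integrable_frobenius_number])
  show "AE \<omega> in M. norm (real (genus (semigroup_generated (A \<omega>)))) \<le>
      norm (real_of_int (frobenius_number (semigroup_generated (A \<omega>))))"
  proof (rule AE_I2)
    fix \<omega>
    show "norm (real (genus (semigroup_generated (A \<omega>)))) \<le>
        norm (real_of_int (frobenius_number (semigroup_generated (A \<omega>))))"
      using genus_le_abs_frobenius_number[OF semigroup_generated_0[of "A \<omega>"]]
      unfolding real_norm_def by linarith
  qed
qed measurable

lemma integrable_embedding_dimension:
  "integrable M (\<lambda>\<omega>. real (embedding_dimension (semigroup_generated (A \<omega>))))"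
proof (rule integrableI_bounded)
  show "(\<integral>\<^sup>+\<omega>. ennreal (norm (real (embedding_dimension (semigroup_generated (A \<omega>))))) \<partial>M) < \<infinity>"
    using nn_integral_embedding_dimension by (auto simp: less_top[symmetric] top_unique)
qed measurable

lemma abs_expectation_frobenius_number_le:
  "\<bar>\<integral>\<omega>. real_of_int (frobenius_number (semigroup_generated (A \<omega>))) \<partial>M\<bar>
     \<le> real threshold * (1 + geometric_const)"
proof -
  let ?F = "\<lambda>\<omega>. real_of_int (frobenius_number (semigroup_generated (A \<omega>)))"
  have "ennreal (\<integral>\<omega>. \<bar>?F \<omega>\<bar> \<partial>M) = (\<integral>\<^sup>+\<omega>. ennreal \<bar>?F \<omega>\<bar> \<partial>M)"
    using integrable_frobenius_number by (intro nn_integral_eq_integral[symmetric]) auto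
  also note nn_integral_abs_frobenius_number
  finally have "(\<integral>\<omega>. \<bar>?F \<omega>\<bar> \<partial>M) \<le> real threshold * (1 + geometric_const)"
    using geometric_const_nonneg by (simp add: ennreal_le_iff)
  then show ?thesis using integral_abs_bound[of M ?F] by linarith
qed

lemma expectation_embedding_dimension_le:
  "(\<integral>\<omega>. real (embedding_dimension (semigroup_generated (A \<omega>))) \<partial>M)
     \<le> 2 * (real threshold * p) * (1 + geometric_const)"
proof -
  let ?e = "\<lambda>\<omega>. real (embedding_dimension (semigroup_generated (A \<omega>)))"
  have "ennreal (\<integral>\<omega>. ?e \<omega> \<partial>M) = (\<integral>\<^sup>+\<omega>. ennreal (?e \<omega>) \<partial>M)"
    using integrable_embedding_dimension by (intro nn_integral_eq_integral[symmetric]) auto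
  also note nn_integral_embedding_dimension
  finally show ?thesis
    using geometric_const_nonneg p_nonneg by (simp add: ennreal_le_iff)
qed

end

section \<open>Comparison of the expected genus with the expected Frobenius number\<close>

context scaled_ER_random_set
begin

text \<open>The genus exceeds the Frobenius number only when \<open>1 \<in> A\<close>, by 1 and with probability \<open>p\<close>. This is
  compensated by the two disjoint events that \<open>A\<close> starts with 2 or 3 and omits the next integer,
  on each of which the Frobenius number exceeds the genus.\<close>

lemma expectation_genus_le_frobenius_number:
  assumes "p \<le> 1 / 5"
  shows "(\<integral>\<omega>. real (genus (semigroup_generated (A \<omega>))) \<partial>M)
     \<le> (\<integral>\<omega>. real_of_int (frobenius_number (semigroup_generated (A \<omega>))) \<partial>M)"
proof -
  let ?S = "\<lambda>\<omega>. semigroup_generated (A \<omega>)"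
  define E where "E X Y = {\<omega> \<in> space M. X \<subseteq> A \<omega> \<and> A \<omega> \<inter> Y = {}}" for X Y
  have [measurable]: "E X Y \<in> events" for X Y unfolding E_def by (rule sets_pattern)
  \<comment> \<open>A lower bound, valid almost surely, for the Frobenius number minus the
    genus.\<close>
  let ?h = "\<lambda>\<omega>. indicat_real (E {2} {1, 3}) \<omega> + indicat_real (E {3} {1, 2, 4}) \<omega> - indicat_real (E {1} {}) \<omega>"
  have 1: "prob (E {1} {}) = p"
    unfolding E_def by (subst prob_pattern) auto
  have 2: "prob (E {2} {1, 3}) = p * (1 - p) ^ 2"
    unfolding E_def by (subst prob_pattern) (auto simp: eval_nat_numeral)
  have 3: "prob (E {3} {1, 2, 4}) = p * (1 - p) ^ 3"
    unfolding E_def by (subst prob_pattern) (auto simp: eval_nat_numeral)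
  have int: "integrable M (indicat_real (E X Y))" for X Y
    by (intro integrable_real_indicator) (auto simp: emeasure_eq_measure)
  \<comment> \<open>16/25 + 64/125 = 144/125 exceeds 1, so the two gains outweigh the loss.\<close>
  have "(4 / 5) ^ 2 \<le> (1 - p) ^ 2" "(4 / 5) ^ 3 \<le> (1 - p) ^ 3"
    using assms by (intro power_mono; simp)+
  then have "1 \<le> (1 - p) ^ 2 + (1 - p) ^ 3" by (simp add: power2_eq_square power3_eq_cube)
  then have "p * 1 \<le> p * ((1 - p) ^ 2 + (1 - p) ^ 3)" using p_pos by (intro mult_left_mono) auto
  then have "0 \<le> prob (E {2} {1, 3}) + prob (E {3} {1, 2, 4}) - prob (E {1} {})"
    unfolding 1 2 3 by (simp add: algebra_simps)
  also have "\<dots> = (\<integral>\<omega>. ?h \<omega> \<partial>M)"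
    using int by simp
  also have "\<dots> \<le> (\<integral>\<omega>. real_of_int (frobenius_number (?S \<omega>)) - real (genus (?S \<omega>)) \<partial>M)"
  proof (rule integral_mono_AE)
    show "integrable M ?h" using int by simp
    show "integrable M (\<lambda>\<omega>. real_of_int (frobenius_number (?S \<omega>)) - real (genus (?S \<omega>)))"
      using integrable_frobenius_number integrable_genus by simp
    show "AE \<omega> in M. ?h \<omega> \<le> real_of_int (frobenius_number (?S \<omega>)) - real (genus (?S \<omega>))"
      using AE_cofinite
    proof (rule AE_mp, intro AE_I2 impI)
      fix \<omega> assume \<omega>: "\<omega> \<in> space M" and fin: "finite (- ?S \<omega>)"
      have mem: "n \<in> A \<omega> \<Longrightarrow> n \<in> ?S \<omega>" for n by (rule semigroup_generated_gen)
      have pos: "0 \<notin> A \<omega>" using positive \<omega> by simp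
      have zero: "0 \<in> ?S \<omega>" by (rule semigroup_generated_0)
      have strict: "real_of_int (frobenius_number (?S \<omega>)) - real (genus (?S \<omega>)) \<ge> 1"
        if "a \<in> A \<omega>" "Suc a \<notin> ?S \<omega>" "0 < a" for a
        using genus_less_frobenius_number[OF zero mem[OF that(1)] that(2,3) _ fin] by simp
      consider "1 \<in> A \<omega>" | "1 \<notin> A \<omega>" "\<omega> \<in> E {2} {1, 3}" | "1 \<notin> A \<omega>" "\<omega> \<in> E {3} {1, 2, 4}"
        | "1 \<notin> A \<omega>" "\<omega> \<notin> E {2} {1, 3}" "\<omega> \<notin> E {3} {1, 2, 4}"
        by blast
      then show "?h \<omega> \<le> real_of_int (frobenius_number (?S \<omega>)) - real (genus (?S \<omega>))"
      proof cases
        case 1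
        have "?S \<omega> = UNIV"
          using semigroup_generated_mult[OF mem[OF 1]] by auto
        then show ?thesis using 1 \<omega> by (simp add: frobenius_number_def genus_def E_def)
      next
        case 2
        then have A: "2 \<in> A \<omega>" "3 \<notin> A \<omega>" by (auto simp: E_def)
        \<comment> \<open>The set on the right contains \<open>A \<omega>\<close>, is closed under
          addition and omits 3.\<close>
        have "?S \<omega> \<subseteq> {n. n = 0 \<or> n = 2 \<or> 4 \<le> n}"
        proof (rule semigroup_generated_least)
          show "A \<omega> \<subseteq> {n. n = 0 \<or> n = 2 \<or> 4 \<le> n}"
          proof
            fix n assume "n \<in> A \<omega>"
            then have "n \<noteq> 1" "n \<noteq> 3" using 2(1) A(2) by auto
            then show "n \<in> {n. n = 0 \<or> n = 2 \<or> 4 \<le> n}" by auto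
          qed
        qed auto
        then have "Suc 2 \<notin> ?S \<omega>" by auto
        then show ?thesis using strict[OF A(1)] A 2 by (simp add: E_def)
      next
        case 3
        then have A: "3 \<in> A \<omega>" "2 \<notin> A \<omega>" "4 \<notin> A \<omega>" by (auto simp: E_def)
        have "?S \<omega> \<subseteq> {n. n = 0 \<or> n = 3 \<or> 5 \<le> n}"
        proof (rule semigroup_generated_least)
          show "A \<omega> \<subseteq> {n. n = 0 \<or> n = 3 \<or> 5 \<le> n}"
          proof
            fix n assume "n \<in> A \<omega>"
            then have "n \<noteq> 1" "n \<noteq> 2" "n \<noteq> 4" using 3(1) A(2,3) by auto
            then show "n \<in> {n. n = 0 \<or> n = 3 \<or> 5 \<le> n}" by auto
          qed
        qed auto
        then have "Suc 3 \<notin> ?S \<omega>" by auto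
        then show ?thesis using strict[OF A(1)] A 3 by (simp add: E_def)
      next
        case 4
        have "?S \<omega> \<subseteq> {n. n \<noteq> 1}"
        proof (rule semigroup_generated_least)
          show "A \<omega> \<subseteq> {n. n \<noteq> 1}" using 4(1) by auto
          show "a + b \<in> {n. n \<noteq> 1}" if "a \<in> {n. n \<noteq> 1}" "b \<in> {n. n \<noteq> 1}" for a b :: nat
            using that by (cases a; cases b) auto
        qed simp
        then have "1 \<notin> ?S \<omega>" by blast
        then have "?S \<omega> \<noteq> UNIV" by blast
        from genus_le_frobenius_number[OF zero this]
        have "0 \<le> real_of_int (frobenius_number (?S \<omega>)) - real (genus (?S \<omega>))" by linarith
        then show ?thesis using 4 by (simp add: E_def)
      qed
    qed
  qed
  also have "\<dots> = (\<integral>\<omega>. real_of_int (frobenius_number (?S \<omega>)) \<partial>M) - (\<integral>\<omega>. real (genus (?S \<omega>)) \<partial>M)"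
    by (rule Bochner_Integration.integral_diff[OF integrable_frobenius_number integrable_genus])
  finally show ?thesis by simp
qed

end

section \<open>Choice of the scale and the asymptotic bounds\<close>

definition scale_length :: "real \<Rightarrow> nat" where
  "scale_length p = nat \<lceil>12 * ln (1 / p) / p\<rceil>"

text \<open>As 5/4 is at least \<open>exp (1 / 5)\<close>, the factor 10 makes
  \<open>(5 / 4) ^ J\<close> at least \<open>1 / p ^ 2\<close>, which exceeds the block length for
  small \<open>p\<close>.\<close>

definition scale_steps :: "real \<Rightarrow> nat" where
  "scale_steps p = nat \<lceil>10 * ln (1 / p)\<rceil>"

text \<open>After rounding, \<open>W\<close> is at most \<open>13 * ln (1 / p) / p\<close> and
  \<open>J + 1\<close> at most \<open>12 * ln (1 / p)\<close>; the constant is 3744 = 2 * 12 * 12 *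
  13.\<close>

lemma
  assumes "ER_random_set M A p" "0 < p" "p \<le> 1 / 5" "1 \<le> ln (1 / p)" "17 * ln (1 / p) * p \<le> 1"
  shows scaled_ER_random_set_scale: "scaled_ER_random_set M A p (scale_length p) (scale_steps p)"
    and threshold_le: "real (scaled_ER_random_set.threshold (scale_length p) (scale_steps p))
      \<le> 3744 * (1 / p * ln (1 / p) ^ 3)"
proof -
  interpret ER_random_set M A p by fact
  let ?W = "scale_length p" and ?J = "scale_steps p" and ?L = "ln (1 / p)"
  have Lp: "1 \<le> ?L / p" using assms by (simp add: field_simps)
  have ceiling_le: "real (nat \<lceil>x\<rceil>) \<le> x + 1" if "0 \<le> x" for x :: real
    using that of_int_ceiling_le_add_one[of x] by simp
  have W: "12 * ?L / p \<le> real ?W"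
    unfolding scale_length_def by (rule of_nat_ceiling)
  have "real ?W \<le> 12 * ?L / p + 1"
    unfolding scale_length_def using assms(2,4)
    by (intro ceiling_le divide_nonneg_pos mult_nonneg_nonneg) linarith+
  then have W': "real ?W \<le> 13 * (?L / p)" using Lp by simp
  have J: "10 * ?L \<le> real ?J"
    unfolding scale_steps_def by (rule of_nat_ceiling)
  have "real ?J \<le> 10 * ?L + 1"
    unfolding scale_steps_def using assms(4) by (intro ceiling_le) linarith
  then have J': "real (?J + 1) \<le> 12 * ?L" using assms(4) by simp
  show "scaled_ER_random_set M A p ?W ?J"
  proof
    show "0 < p" "p \<le> 1 / 2" using assms by auto
    show "12 * ?L / p \<le> real ?W" by (rule W)
    show "2 \<le> ?W" using W Lp by simp
    have "real (?J + 1) * p \<le> 12 * ?L * p" using J' assms(2) by (intro mult_right_mono) auto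
    also have "\<dots> \<le> 17 * ?L * p" using assms by (intro mult_right_mono) auto
    finally show "real (?J + 1) * p \<le> 1" using assms(5) by linarith
    \<comment> \<open>Taking reciprocals gives \<open>exp (1 / 5) \<le> 5 / 4\<close>.\<close>
    have "4 / 5 \<le> exp (- (1 / 5) :: real)" using exp_ge_add_one_self[of "- (1 / 5) :: real"] by simp
    then have "exp (1 / 5) \<le> (5 / 4 :: real)" by (simp add: exp_minus field_simps)
    have "13 * (?L / p) \<le> (1 / p) ^ 2"
      using assms by (simp add: power2_eq_square field_simps)
    also have "\<dots> = exp ?L ^ 2" using assms(2) by simp
    also have "\<dots> = exp (2 * ?L)" using exp_of_nat_mult[of 2 ?L] by simp
    also have "\<dots> \<le> exp (real ?J * (1 / 5))" using J by simp
    also have "\<dots> = exp (1 / 5) ^ ?J" by (rule exp_of_nat_mult)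
    also have "\<dots> \<le> (5 / 4) ^ ?J" using \<open>exp (1 / 5) \<le> 5 / 4\<close> by (intro power_mono) auto
    finally show "real ?W \<le> (5 / 4) ^ ?J" using W' by linarith
  qed
  then interpret scaled_ER_random_set M A p ?W ?J .
  have "real threshold = 2 * real (?J + 1) ^ 2 * real ?W" by (simp add: threshold_def)
  also have "\<dots> \<le> 2 * (12 * ?L) ^ 2 * (13 * (?L / p))"
    using J' W' by (intro mult_mono power_mono) auto
  also have "\<dots> = 3744 * (1 / p * ?L ^ 3)"
    by (simp add: power2_eq_square power3_eq_cube)
  finally show "real (scaled_ER_random_set.threshold ?W ?J) \<le> 3744 * (1 / p * ?L ^ 3)" .
qed

theorem theorem1p6:
  fixes M :: "real \<Rightarrow> 'a measure"
    and A :: "real \<Rightarrow> 'a \<Rightarrow> nat set"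
    and S :: "real \<Rightarrow> 'a \<Rightarrow> nat set"
  assumes ER: "\<And>p. 0 < p \<Longrightarrow> p < 1 \<Longrightarrow> ER_random_set (M p) (A p) p"
    and S: "\<And>p \<omega>. S p \<omega> = semigroup_generated (A p \<omega>)"
  shows "(\<forall>\<^sub>F p in at_right 0.
            integrable (M p) (\<lambda>\<omega>. real (embedding_dimension (S p \<omega>))) \<and>
            integrable (M p) (\<lambda>\<omega>. real (genus (S p \<omega>))) \<and>
            integrable (M p) (\<lambda>\<omega>. real_of_int (frobenius_number (S p \<omega>)))) \<and>
         (\<lambda>p. \<integral>\<omega>. real (embedding_dimension (S p \<omega>)) \<partial>M p)
            \<in> O[at_right 0](\<lambda>p. ln (1 / p) ^ 3) \<and>
         (\<forall>\<^sub>F p in at_right 0.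
            (\<integral>\<omega>. real (genus (S p \<omega>)) \<partial>M p)
              \<le> (\<integral>\<omega>. real_of_int (frobenius_number (S p \<omega>)) \<partial>M p)) \<and>
         (\<lambda>p. \<integral>\<omega>. real_of_int (frobenius_number (S p \<omega>)) \<partial>M p)
            \<in> O[at_right 0](\<lambda>p. 1 / p * ln (1 / p) ^ 3)"
proof -
  define K where "K = 3744 * (1 + geometric_const)"
  define small where "small p \<longleftrightarrow> 0 < p \<and> p \<le> 1 / 5 \<and> 1 \<le> ln (1 / p) \<and> 17 * ln (1 / p) * p \<le> 1"
    for p :: real
  have small: "\<forall>\<^sub>F p in at_right 0. small p"
  proof -
    have "\<forall>\<^sub>F p :: real in at_right 0. 0 < p" by (rule eventually_at_right_less)
    moreover have "\<forall>\<^sub>F p :: real in at_right 0. p \<le> 1 / 5" by real_asymp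
    moreover have "\<forall>\<^sub>F p :: real in at_right 0. 1 \<le> ln (1 / p)" by real_asymp
    moreover have "\<forall>\<^sub>F p :: real in at_right 0. 17 * ln (1 / p) * p \<le> 1" by real_asymp
    ultimately show ?thesis unfolding small_def by eventually_elim simp
  qed
  have norm_ln_cube: "norm (ln (1 / p) ^ 3) = ln (1 / p) ^ 3" if "small p" for p
  proof -
    have "0 \<le> ln (1 / p) ^ 3" using that by (intro zero_le_power) (simp only: small_def, linarith)
    then show ?thesis by (simp only: real_norm_def abs_of_nonneg)
  qed
  have scaled: "scaled_ER_random_set (M p) (A p) p (scale_length p) (scale_steps p)"
    and threshold: "real (scaled_ER_random_set.threshold (scale_length p) (scale_steps p))
      \<le> 3744 * (1 / p * ln (1 / p) ^ 3)" if "small p" for p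
    using scaled_ER_random_set_scale[OF ER] threshold_le[OF ER] that by (auto simp: small_def)
  have "\<forall>\<^sub>F p in at_right 0.
            integrable (M p) (\<lambda>\<omega>. real (embedding_dimension (S p \<omega>))) \<and>
            integrable (M p) (\<lambda>\<omega>. real (genus (S p \<omega>))) \<and>
            integrable (M p) (\<lambda>\<omega>. real_of_int (frobenius_number (S p \<omega>)))"
    using small
  proof eventually_elim
    case (elim p)
    show ?case
      unfolding S using scaled_ER_random_set.integrable_embedding_dimension[OF scaled[OF elim]]
        scaled_ER_random_set.integrable_genus[OF scaled[OF elim]]
        scaled_ER_random_set.integrable_frobenius_number[OF scaled[OF elim]] by blast
  qed
  moreover have "(\<lambda>p. \<integral>\<omega>. real (embedding_dimension (S p \<omega>)) \<partial>M p)
      \<in> O[at_right 0](\<lambda>p. ln (1 / p) ^ 3)"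
  proof (rule bigoI[where c = "2 * K"])
    show "\<forall>\<^sub>F p in at_right 0. norm (\<integral>\<omega>. real (embedding_dimension (S p \<omega>)) \<partial>M p)
        \<le> 2 * K * norm (ln (1 / p) ^ 3)"
      using small
    proof eventually_elim
      case (elim p)
      then have p: "0 < p" "1 \<le> ln (1 / p)" by (auto simp: small_def)
      interpret scaled_ER_random_set "M p" "A p" p "scale_length p" "scale_steps p"
        by (rule scaled[OF elim])
      have "(\<integral>\<omega>. real (embedding_dimension (S p \<omega>)) \<partial>M p)
          \<le> 2 * (real threshold * p) * (1 + geometric_const)"
        unfolding S by (rule expectation_embedding_dimension_le)
      also have "\<dots> \<le> 2 * (3744 * (1 / p * ln (1 / p) ^ 3) * p) * (1 + geometric_const)"
        using threshold[OF elim] p geometric_const_nonneg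
        by (intro mult_right_mono mult_left_mono) auto
      \<comment> \<open>The density \<open>p\<close> of generators cancels the \<open>1 / p\<close>
        of the threshold.\<close>
      also have "\<dots> = 2 * K * ln (1 / p) ^ 3" using p by (simp add: K_def)
      also have "ln (1 / p) ^ 3 = norm (ln (1 / p) ^ 3)"
        by (rule norm_ln_cube[OF elim, symmetric])
      finally show ?case by (simp add: integral_nonneg_AE)
    qed
  qed
  moreover have "\<forall>\<^sub>F p in at_right 0. (\<integral>\<omega>. real (genus (S p \<omega>)) \<partial>M p)
      \<le> (\<integral>\<omega>. real_of_int (frobenius_number (S p \<omega>)) \<partial>M p)"
    using small
  proof eventually_elim
    case (elim p)
    then show ?case
      unfolding S using scaled_ER_random_set.expectation_genus_le_frobenius_number[OF scaled[OF elim]]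
      by (simp add: small_def)
  qed
  moreover have "(\<lambda>p. \<integral>\<omega>. real_of_int (frobenius_number (S p \<omega>)) \<partial>M p)
      \<in> O[at_right 0](\<lambda>p. 1 / p * ln (1 / p) ^ 3)"
  proof (rule bigoI[where c = K])
    show "\<forall>\<^sub>F p in at_right 0. norm (\<integral>\<omega>. real_of_int (frobenius_number (S p \<omega>)) \<partial>M p)
        \<le> K * norm (1 / p * ln (1 / p) ^ 3)"
      using small
    proof eventually_elim
      case (elim p)
      then have p: "0 < p" "1 \<le> ln (1 / p)" by (auto simp: small_def)
      interpret scaled_ER_random_set "M p" "A p" p "scale_length p" "scale_steps p"
        by (rule scaled[OF elim])
      have "norm (\<integral>\<omega>. real_of_int (frobenius_number (S p \<omega>)) \<partial>M p)
          \<le> real threshold * (1 + geometric_const)"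
        unfolding S real_norm_def by (rule abs_expectation_frobenius_number_le)
      also have "\<dots> \<le> 3744 * (1 / p * ln (1 / p) ^ 3) * (1 + geometric_const)"
        using threshold[OF elim] geometric_const_nonneg by (intro mult_right_mono) auto
      also have "\<dots> = K * (1 / p * ln (1 / p) ^ 3)" by (simp add: K_def)
      also have "1 / p * ln (1 / p) ^ 3 = norm (1 / p * ln (1 / p) ^ 3)"
        using p by (simp only: norm_mult norm_ln_cube[OF elim]) simp
      finally show ?case .
    qed
  qed
  ultimately show ?thesis by blast
qed

end
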